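(* Let $X=\alpha_1\times\dots\times\alpha_n$ be a cartesian product of $n\ge1$ infinite ordinals and let $k_1,\dots,k_m\in\mathbb{N}$. Then $$\mathbf{w}(X\times k_1\times\dots\times k_m)=\mathbf{w}(X)\otimes k_1\otimes\dots\otimes k_m.$$
   Context: Each $k_j\in\mathbb{N}$ is viewed as the finite ordinal (chain) $\{0<1<\dots<k_j-1\}$; products have the componentwise order. The width $\mathbf{w}(A)$ of a wqo $A$ is the rank of the forest of nonempty finite sequences of pairwise incomparable elements of $A$ ordered by initial segment. $\otimes$ is the natural (Hessenberg) product of ordinals. *)

theory Defs
  imports Main "HOL-Library.Sublist"
begin

text \<open>Ordinals are represented as elements of a type of class wellorder. The ordinal
  operations below are the standard ones, defined by least elements / well-founded recursion.\<close>

definition ozero :: "'o::wellorder" where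
  "ozero = (LEAST y. True)"

definition osucc :: "'o::wellorder \<Rightarrow> 'o" where
  "osucc x = (LEAST y. x < y)"

definition osup :: "'o::wellorder set \<Rightarrow> 'o" where
  "osup S = (LEAST y. \<forall>s\<in>S. s \<le> y)"

definition ofnat :: "nat \<Rightarrow> 'o::wellorder" where
  "ofnat k = (osucc ^^ k) ozero"

definition pair_below :: "(('o::wellorder \<times> 'o) \<times> ('o \<times> 'o)) set" where
  "pair_below = {((a', b'), (a, b)). a' \<le> a \<and> b' \<le> b \<and> (a', b') \<noteq> (a, b)}"

definition nsum :: "'o::wellorder \<Rightarrow> 'o \<Rightarrow> 'o" where
  "nsum a b = wfrec pair_below
     (\<lambda>f (x, y). LEAST c. (\<forall>x'<x. f (x', y) < c) \<and> (\<forall>y'<y. f (x, y') < c)) (a, b)"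

text \<open>Natural (Hessenberg) product (Conway's definition): the least c such that
  c (+) (a' (x) b') > (a' (x) b) (+) (a (x) b') for all a' < a, b' < b.\<close>
definition nprod :: "'o::wellorder \<Rightarrow> 'o \<Rightarrow> 'o" where
  "nprod a b = wfrec pair_below
     (\<lambda>f (x, y). LEAST c. \<forall>x'<x. \<forall>y'<y.
         nsum (f (x', y)) (f (x, y')) < nsum c (f (x', y'))) (a, b)"

text \<open>R contains pairs (t, s) with t strictly above s in the forest (t a proper extension of s).
  rank s = sup { rank t + 1 | t above s }.\<close>
definition node_rank :: "('n \<times> 'n) set \<Rightarrow> 'n \<Rightarrow> 'o::wellorder" where
  "node_rank R = wfrec R (\<lambda>\<rho> x. osup {osucc (\<rho> y) | y. (y, x) \<in> R})"

definition forest_rank :: "'n set \<Rightarrow> ('n \<times> 'n) set \<Rightarrow> 'o::wellorder" where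
  "forest_rank P R = osup {osucc (node_rank R x) | x. x \<in> P}"

definition inc_seqs :: "'x set \<Rightarrow> ('x \<Rightarrow> 'x \<Rightarrow> bool) \<Rightarrow> 'x list set" where
  "inc_seqs A le = {s. s \<noteq> [] \<and> set s \<subseteq> A \<and>
      (\<forall>i<length s. \<forall>j<length s. i \<noteq> j \<longrightarrow> \<not> le (s ! i) (s ! j))}"

definition inc_forest :: "'x set \<Rightarrow> ('x \<Rightarrow> 'x \<Rightarrow> bool) \<Rightarrow> ('x list \<times> 'x list) set" where
  "inc_forest A le = {(t, s). t \<in> inc_seqs A le \<and> s \<in> inc_seqs A le \<and> strict_prefix s t}"

definition width :: "'x set \<Rightarrow> ('x \<Rightarrow> 'x \<Rightarrow> bool) \<Rightarrow> 'o::wellorder" where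
  "width A le = forest_rank (inc_seqs A le) (inc_forest A le)"

definition small_set :: "'o set \<Rightarrow> bool" where
  "small_set S \<longleftrightarrow> \<not> (\<exists>f::'o \<Rightarrow> 'o. inj f \<and> range f \<subseteq> S)"

text \<open>The order type of 'o is a regular cardinal: every proper initial segment is small,
  and every small set is strictly bounded.\<close>
definition regular_ordinal_type :: "'o::wellorder itself \<Rightarrow> bool" where
  "regular_ordinal_type _ \<longleftrightarrow>
     (\<forall>a::'o. small_set {b. b < a}) \<and>
     (\<forall>S::'o set. small_set S \<longrightarrow> (\<exists>b. \<forall>s\<in>S. s < b))"

end

theory Submission
  imports Defs
begin

text \<open>
  The width satisfies \<open>W A = sup (W (A\<^sub>x) + 1)\<close> over \<open>x \<in> A\<close>, where \<open>A\<^sub>x\<close> is the set of elements of \<open>A\<close>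
  incomparable to \<open>x\<close>. The upper bound holds for every poset \<open>X\<close>: the copies of \<open>X\<close> cover the product,
  and a sequence of incomparable elements has rank at most the natural sum of its ranks in the copies.

  For the lower bound cut every factor \<open>\<alpha>\<^sub>i\<close> into the blocks of its Cantor normal form. This cuts \<open>X\<close>
  into finitely many cells, each a product of additively indecomposable ordinals, and the width of
  such a product is again indecomposable. Two cells \<open>d < e\<close> either share an infinite block in some
  coordinate, or every element of \<open>d\<close> lies below every element of \<open>e\<close>. Hence \<open>W X\<close> is at most the
  natural sum of the widths of a set \<open>S\<close> of cells without pairs of the second kind; as the \<open>\<alpha>\<^sub>i\<close> are
  infinite, \<open>S\<close> can be chosen without one-point cells. Conversely, all copies of all cells of \<open>S\<close> can
  be played one after another, those of small width first and upper ones before lower ones: after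
  finitely many moves in the earlier cells, shifting along the shared infinite blocks embeds the
  current cell into the set of its elements that are still incomparable to all the moves.
\<close>

section \<open>Incomparable sequences\<close>

text \<open>The elements that may still be played after the moves in \<open>F\<close>.\<close>

definition apart :: "('x \<Rightarrow> 'x \<Rightarrow> bool) \<Rightarrow> 'x set \<Rightarrow> 'x set \<Rightarrow> 'x set" where
  "apart le A F = {y \<in> A. \<forall>x\<in>F. \<not> le x y \<and> \<not> le y x}"

lemma apart_apart: "apart le (apart le A F) G = apart le A (F \<union> G)"
  by (auto simp: apart_def)

lemma apart_empty [simp]: "apart le A {} = A"
  by (simp add: apart_def)

lemma apart_subset: "apart le A F \<subseteq> A"
  by (auto simp: apart_def)

lemma inc_seqs_iff:
  "s \<in> inc_seqs A le \<longleftrightarrow> s \<noteq> [] \<and> set s \<subseteq> A \<and> sorted_wrt (\<lambda>x y. \<not> le x y \<and> \<not> le y x) s"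
  unfolding inc_seqs_def sorted_wrt_iff_nth_less
  by (auto, metis linorder_neqE_nat)

lemma inc_seqs_append:
  assumes "s \<in> inc_seqs A le" "u \<noteq> []"
  shows "s @ u \<in> inc_seqs A le \<longleftrightarrow> u \<in> inc_seqs (apart le A (set s)) le"
  using assms unfolding inc_seqs_iff sorted_wrt_append apart_def by auto

lemma inc_seqs_singleton: "x \<in> A \<Longrightarrow> [x] \<in> inc_seqs A le"
  by (simp add: inc_seqs_iff)

lemma inc_forest_iff:
  "(t, s) \<in> inc_forest A le \<longleftrightarrow> s \<in> inc_seqs A le \<and> (\<exists>u. t = s @ u \<and> u \<in> inc_seqs (apart le A (set s)) le)"
proof
  assume "(t, s) \<in> inc_forest A le"
  then have *: "t \<in> inc_seqs A le" "s \<in> inc_seqs A le" "strict_prefix s t"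
    by (auto simp: inc_forest_def)
  then obtain u where "t = s @ u" "u \<noteq> []" by (auto simp: strict_prefix_def prefix_def)
  then show "s \<in> inc_seqs A le \<and> (\<exists>u. t = s @ u \<and> u \<in> inc_seqs (apart le A (set s)) le)"
    using * inc_seqs_append by blast
next
  assume *: "s \<in> inc_seqs A le \<and> (\<exists>u. t = s @ u \<and> u \<in> inc_seqs (apart le A (set s)) le)"
  then obtain u where u: "t = s @ u" "u \<in> inc_seqs (apart le A (set s)) le" by blast
  then have "u \<noteq> []" by (simp add: inc_seqs_iff)
  then show "(t, s) \<in> inc_forest A le"
    using * u inc_seqs_append [of s A le u] by (auto simp: inc_forest_def strict_prefix_def prefix_def)
qed

lemma node_rank_unfold:
  assumes "wf R"
  shows "node_rank R x = osup {osucc (node_rank R y) | y. (y, x) \<in> R}"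
proof -
  have "node_rank R x = osup {osucc (cut (node_rank R) R x y) | y. (y, x) \<in> R}"
    unfolding node_rank_def by (subst wfrec [OF assms]) simp
  also have "{osucc (cut (node_rank R) R x y) | y. (y, x) \<in> R} = {osucc (node_rank R y) | y. (y, x) \<in> R}"
    by (metis cut_apply)
  finally show ?thesis .
qed

definition no_infinite_antichain :: "('x \<Rightarrow> 'x \<Rightarrow> bool) \<Rightarrow> 'x set \<Rightarrow> bool" where
  "no_infinite_antichain le A \<longleftrightarrow>
     \<not> (\<exists>f::nat \<Rightarrow> 'x. range f \<subseteq> A \<and> (\<forall>i j. i < j \<longrightarrow> \<not> le (f i) (f j) \<and> \<not> le (f j) (f i)))"

text \<open>A descending chain in the forest is a branch of ever longer prefixes, so the
  \<open>i\<close>-th entry of the \<open>i\<close>-th node never changes again; these diagonal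
  entries would form an infinite antichain.\<close>

lemma wf_inc_forest:
  assumes "no_infinite_antichain le A"
  shows "wf (inc_forest A le)"
  unfolding wf_iff_no_infinite_down_chain
proof
  assume "\<exists>S. \<forall>i. (S (Suc i), S i) \<in> inc_forest A le"
  then obtain S where S: "\<And>i. (S (Suc i), S i) \<in> inc_forest A le" by blast
  have inc: "S i \<in> inc_seqs A le" for i using S [of i] by (simp add: inc_forest_def)
  have len: "i < length (S i)" for i
  proof (induction i)
    case 0
    then show ?case using inc [of 0] by (simp add: inc_seqs_iff)
  next
    case (Suc i)
    then show ?case using S [of i] by (auto simp: inc_forest_def dest!: prefix_length_less)
  qed
  have pre: "prefix (S i) (S j)" if "i \<le> j" for i j
    using that
  proof (induction j rule: dec_induct)
    case (step n)
    then show ?case using S [of n] by (auto simp: inc_forest_def strict_prefix_def intro: prefix_order.trans)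
  qed simp
  define f where "f i = S i ! i" for i
  have "range f \<subseteq> A"
  proof
    fix x assume "x \<in> range f"
    then obtain i where "x = S i ! i" by (auto simp: f_def)
    then show "x \<in> A" using inc [of i] len [of i] nth_mem unfolding inc_seqs_def by blast
  qed
  moreover have "\<not> le (f i) (f j) \<and> \<not> le (f j) (f i)" if "i < j" for i j
  proof -
    have "f i = S j ! i"
      using pre [of i j] that len [of i] by (auto simp: f_def prefix_def nth_append)
    then show ?thesis
      using inc [of j] that len [of j] unfolding f_def inc_seqs_def by auto
  qed
  ultimately show False using assms unfolding no_infinite_antichain_def by blast
qed

lemma no_infinite_antichain_subset:
  "no_infinite_antichain le A \<Longrightarrow> B \<subseteq> A \<Longrightarrow> no_infinite_antichain le B"
  unfolding no_infinite_antichain_def by blast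

text \<open>Cutting off \<open>s\<close> identifies the part of the forest above \<open>s\<close>
  with the forest of the residual; the induction transports the ranks.\<close>

lemma node_rank_append:
  assumes "no_infinite_antichain le A" "s \<in> inc_seqs A le" "u \<in> inc_seqs (apart le A (set s)) le"
  shows "(node_rank (inc_forest A le) (s @ u) :: 'o::wellorder) = node_rank (inc_forest (apart le A (set s)) le) u"
proof -
  let ?A = "apart le A (set s)"
  have wfs: "wf (inc_forest A le)" "wf (inc_forest ?A le)"
    using assms(1) by (auto intro!: wf_inc_forest intro: no_infinite_antichain_subset [OF _ apart_subset])
  show ?thesis using assms(3)
  proof (induction u rule: wf_induct_rule [OF wfs(2)])
    case (1 u)
    have su: "s @ u \<in> inc_seqs A le"
      using 1(2) assms(2) inc_seqs_append by (metis inc_seqs_iff)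
    have ext: "(y, s @ u) \<in> inc_forest A le \<longleftrightarrow> (\<exists>t. y = s @ t \<and> (t, u) \<in> inc_forest ?A le)" for y
      using su 1(2) by (auto simp: inc_forest_iff apart_apart)
    have "{osucc (node_rank (inc_forest A le) y :: 'o) | y. (y, s @ u) \<in> inc_forest A le}
      = {osucc (node_rank (inc_forest A le) (s @ t)) | t. (t, u) \<in> inc_forest ?A le}"
      unfolding ext by blast
    also have "\<dots> = {osucc (node_rank (inc_forest ?A le) t) | t. (t, u) \<in> inc_forest ?A le}"
    proof -
      have "node_rank (inc_forest A le) (s @ t) = (node_rank (inc_forest ?A le) t :: 'o)"
        if "(t, u) \<in> inc_forest ?A le" for t
        using 1(1) [OF that] that by (simp add: inc_forest_def)
      then show ?thesis by (intro Collect_cong iff_exI) auto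
    qed
    finally show ?case
      by (simp only: node_rank_unfold [OF wfs(1), of "s @ u"] node_rank_unfold [OF wfs(2), of u])
  qed
qed

lemma node_rank_eq_width:
  assumes "no_infinite_antichain le A" "s \<in> inc_seqs A le"
  shows "(node_rank (inc_forest A le) s :: 'o::wellorder) = width (apart le A (set s)) le"
proof -
  let ?A = "apart le A (set s)"
  have "{osucc (node_rank (inc_forest A le) y :: 'o) | y. (y, s) \<in> inc_forest A le}
    = {osucc (node_rank (inc_forest A le) (s @ u)) | u. u \<in> inc_seqs ?A le}"
    using assms(2) by (auto simp: inc_forest_iff)
  also have "\<dots> = {osucc (node_rank (inc_forest ?A le) u) | u. u \<in> inc_seqs ?A le}"
    using node_rank_append [OF assms, where ?'o = 'o] by (intro Collect_cong iff_exI) auto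
  finally have "{osucc (node_rank (inc_forest A le) y :: 'o) | y. (y, s) \<in> inc_forest A le} = \<dots>" .
  then show ?thesis
    unfolding width_def forest_rank_def by (subst node_rank_unfold [OF wf_inc_forest [OF assms(1)]]) simp
qed

text \<open>Every node rank is again a width, which turns the definition by ranks into a recursion
  on residuals of \<open>A\<close>.\<close>

lemma width_eq_osup:
  assumes "no_infinite_antichain le A"
  shows "(width A le :: 'o::wellorder) = osup {osucc (width (apart le A (set s)) le) | s. s \<in> inc_seqs A le}"
proof -
  have "{osucc (node_rank (inc_forest A le) s :: 'o) | s. s \<in> inc_seqs A le}
    = {osucc (width (apart le A (set s)) le) | s. s \<in> inc_seqs A le}"
    using node_rank_eq_width [OF assms, where ?'o = 'o] by (intro Collect_cong iff_exI) auto
  then show ?thesis unfolding width_def [of A] forest_rank_def by simp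
qed

section \<open>Products of well-orders have no infinite antichains\<close>

lemma monotone_subsequence:
  fixes f :: "nat \<Rightarrow> 'a::wellorder"
  obtains r :: "nat \<Rightarrow> nat" where "strict_mono r" "\<And>i j. i \<le> j \<Longrightarrow> f (r i) \<le> f (r j)"
proof -
  \<comment> \<open>Take \<open>k\<close> where the least value of the tail from \<open>m\<close> on
    is attained; choosing such an index beyond each previous one gives the subsequence.\<close>
  have "\<exists>k\<ge>m. \<forall>l\<ge>m. f k \<le> f l" for m
  proof -
    obtain y where y: "y \<in> f ` {m..}" "\<And>z. z \<in> f ` {m..} \<Longrightarrow> y \<le> z"
      using LeastI [of "\<lambda>y. y \<in> f ` {m..}" "f m"] Least_le [of "\<lambda>y. y \<in> f ` {m..}"] by blast
    then show ?thesis by fastforce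
  qed
  then obtain g where g: "\<And>m. m \<le> g m" "\<And>m l. m \<le> l \<Longrightarrow> f (g m) \<le> f l" by metis
  define r where "r = rec_nat (g 0) (\<lambda>_ p. g (Suc p))"
  have r: "r 0 = g 0" "\<And>i. r (Suc i) = g (Suc (r i))" by (simp_all add: r_def)
  have "r i < r (Suc i)" for i using g(1) [of "Suc (r i)"] by (simp add: r)
  then have mono: "strict_mono r" by (simp add: strict_mono_Suc_iff)
  show thesis
  proof (rule that [OF mono])
    fix i j :: nat assume ij: "i \<le> j"
    show "f (r i) \<le> f (r j)"
    proof (cases i)
      case 0
      then show ?thesis using g(2) [of 0] by (simp add: r)
    next
      case (Suc k)
      have "Suc (r k) \<le> r j" using strict_monoD [OF mono, of k j] Suc ij by simp
      then show ?thesis using g(2) by (simp add: Suc r)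
    qed
  qed
qed

text \<open>Indexing makes lists built by \<open>map\<close> over \<open>[0..<n]\<close> easy to
  compare; on lists of length \<open>n\<close> this agrees with \<open>list_all2\<close>.\<close>

definition vle :: "nat \<Rightarrow> 'a::order list \<Rightarrow> 'a list \<Rightarrow> bool" where
  "vle n x y \<longleftrightarrow> (\<forall>i<n. x ! i \<le> y ! i)"

text \<open>Dickson's argument: passing to a monotone subsequence once per coordinate leaves
  comparable members.\<close>

lemma no_infinite_antichain_vle:
  fixes A :: "'a::wellorder list set"
  shows "no_infinite_antichain (vle n) A"
proof -
  have sub: "\<exists>r::nat \<Rightarrow> nat. strict_mono r \<and> (\<forall>k<n. \<forall>i j. i \<le> j \<longrightarrow> f (r i) ! k \<le> f (r j) ! k)"
    for f :: "nat \<Rightarrow> 'a list"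
  proof (induction n)
    case 0
    then show ?case by (intro exI [of _ id]) (simp add: strict_mono_def)
  next
    case (Suc n)
    then obtain r :: "nat \<Rightarrow> nat" where r: "strict_mono r" "\<forall>k<n. \<forall>i j. i \<le> j \<longrightarrow> f (r i) ! k \<le> f (r j) ! k" by blast
    obtain s :: "nat \<Rightarrow> nat" where s: "strict_mono s" "\<And>i j. i \<le> j \<Longrightarrow> f (r (s i)) ! n \<le> f (r (s j)) ! n"
      by (rule monotone_subsequence [of "\<lambda>i. f (r i) ! n"]) simp
    have "strict_mono (r \<circ> s)" using r(1) s(1) by (simp add: strict_mono_def)
    moreover have "f ((r \<circ> s) i) ! k \<le> f ((r \<circ> s) j) ! k" if "k < Suc n" "i \<le> j" for k i j
      using that r(2) s by (auto simp: less_Suc_eq strict_mono_less_eq)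
    ultimately show ?case by blast
  qed
  show ?thesis
    unfolding no_infinite_antichain_def
  proof
    assume "\<exists>f::nat \<Rightarrow> 'a list. range f \<subseteq> A \<and>
      (\<forall>i j. i < j \<longrightarrow> \<not> vle n (f i) (f j) \<and> \<not> vle n (f j) (f i))"
    then obtain f :: "nat \<Rightarrow> 'a list" where f: "\<And>i j. i < j \<Longrightarrow> \<not> vle n (f i) (f j)" by blast
    obtain r :: "nat \<Rightarrow> nat" where r: "strict_mono r" "\<forall>k<n. \<forall>i j. i \<le> j \<longrightarrow> f (r i) ! k \<le> f (r j) ! k"
      using sub by blast
    have "vle n (f (r 0)) (f (r 1))" using r(2) by (simp add: vle_def)
    then show False using f strict_monoD [OF r(1), of 0 1] by simp
  qed
qed

lemma no_infinite_antichain_embed: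
  assumes "no_infinite_antichain le' A'" "\<And>x. x \<in> A \<Longrightarrow> f x \<in> A'"
    and "\<And>x y. x \<in> A \<Longrightarrow> y \<in> A \<Longrightarrow> le' (f x) (f y) \<Longrightarrow> le x y"
  shows "no_infinite_antichain le A"
  unfolding no_infinite_antichain_def
proof
  assume "\<exists>g::nat \<Rightarrow> _. range g \<subseteq> A \<and> (\<forall>i j. i < j \<longrightarrow> \<not> le (g i) (g j) \<and> \<not> le (g j) (g i))"
  then obtain g :: "nat \<Rightarrow> _" where g: "range g \<subseteq> A"
    "\<And>i j. i < j \<Longrightarrow> \<not> le (g i) (g j) \<and> \<not> le (g j) (g i)" by blast
  have gA: "g i \<in> A" for i using g(1) by auto
  have "range (f \<circ> g) \<subseteq> A'" using gA assms(2) by auto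
  moreover have "\<not> le' ((f \<circ> g) i) ((f \<circ> g) j) \<and> \<not> le' ((f \<circ> g) j) ((f \<circ> g) i)" if "i < j" for i j
    using g(2) [OF that] assms(3) [OF gA gA, of i j] assms(3) [OF gA gA, of j i] by auto
  ultimately show False using assms(1) unfolding no_infinite_antichain_def by blast
qed

lemma width_cong:
  assumes "\<And>x y. x \<in> A \<Longrightarrow> y \<in> A \<Longrightarrow> le x y \<longleftrightarrow> le' x y"
  shows "width A le = width A le'"
proof -
  have "s \<in> inc_seqs A le \<longleftrightarrow> s \<in> inc_seqs A le'" for s
  proof (cases "set s \<subseteq> A")
    case True
    then have "s ! i \<in> A" if "i < length s" for i using that nth_mem by blast
    then show ?thesis unfolding inc_seqs_def using assms by simp
  qed (simp add: inc_seqs_def)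
  then have "inc_seqs A le = inc_seqs A le'" by blast
  then show ?thesis by (simp add: width_def inc_forest_def)
qed

text \<open>It follows that an element with the largest coordinate sum is maximal. This selects the
  next cell to be played in \<open>W_XK_ge\<close>.\<close>

lemma sum_list_strict_mono_list_all2:
  "list_all2 (\<le>) xs ys \<Longrightarrow> xs \<noteq> ys \<Longrightarrow> sum_list xs < sum_list (ys::nat list)"
proof (induction rule: list_all2_induct)
  case (Cons x xs y ys)
  then have "sum_list xs \<le> sum_list ys" by (cases "xs = ys") auto
  then show ?case using Cons by (cases "xs = ys") auto
qed simp

lemma finite_has_maximal_value:
  assumes "finite T" "T \<noteq> {}"
  shows "\<exists>p\<in>T. \<forall>q\<in>T. f q \<le> (f p :: 'b::linorder)"
proof -
  have "Max (f ` T) \<in> f ` T" using assms by (intro Max_in) auto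
  then obtain p where "p \<in> T" "f p = Max (f ` T)" by auto
  then show ?thesis using assms by (intro bexI [of _ p]) auto
qed

section \<open>Counting a product of finite chains\<close>

lemma list_all2_less_Cons:
  "{y. list_all2 (<) y (k # ks)} = (\<lambda>(a, y). a # y) ` ({..<k} \<times> {y. list_all2 (<) y (ks::nat list)})"
  by (auto simp: list_all2_Cons2)

lemma finite_list_all2_less: "finite {y. list_all2 (<) y (ks::nat list)}"
  by (induction ks) (simp_all add: list_all2_less_Cons)

lemma card_list_all2_less: "card {y. list_all2 (<) y (ks::nat list)} = prod_list ks"
proof (induction ks)
  case (Cons k ks)
  have "inj_on (\<lambda>(a, y). a # y) ({..<k} \<times> {y. list_all2 (<) y ks})" by (auto simp: inj_on_def)
  then show ?case unfolding list_all2_less_Cons using Cons by (simp add: card_image card_cartesian_product)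
qed simp

definition pair_le :: "nat \<Rightarrow> 'a::order list \<times> nat list \<Rightarrow> 'a list \<times> nat list \<Rightarrow> bool" where
  "pair_le n p q \<longleftrightarrow> vle n (fst p) (fst q) \<and> list_all2 (\<le>) (snd p) (snd q)"

section \<open>Natural sums\<close>

text \<open>By regularity, families indexed by a proper initial segment are bounded. The infinite
  ordinal \<open>a0\<close> supplies such a segment; in the application it bounds all
  factors.\<close>

locale regular_ordinals =
  fixes a0 :: "'o::wellorder"
  assumes regular: "regular_ordinal_type TYPE('o)"
    and infinite_a0: "infinite {..<a0}"
begin

lemma ozero_le [simp]: "ozero \<le> (x::'o)"
  unfolding ozero_def by (rule Least_le) simp

lemma not_less_ozero [simp]: "\<not> x < (ozero::'o)"
  by (simp add: not_less)

lemma small_imp_bounded: "small_set (S::'o set) \<Longrightarrow> \<exists>b. \<forall>s\<in>S. s < b"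
  using regular unfolding regular_ordinal_type_def by blast

text \<open>This is replacement: if the image were not small it would contain a copy of all of
  \<open>'o\<close>, and pulling that back to \<open>A\<close> and applying \<open>g\<close> would
  embed \<open>'o\<close> into the segment below \<open>a\<close>.\<close>

lemma bounded_image_of_injection:
  fixes f :: "'x \<Rightarrow> 'o"
  assumes "inj_on g A" "g ` A \<subseteq> {..<a::'o}"
  shows "\<exists>b. \<forall>x\<in>A. f x < b"
proof -
  have "small_set (f ` A)"
    unfolding small_set_def
  proof
    assume "\<exists>h::'o \<Rightarrow> 'o. inj h \<and> range h \<subseteq> f ` A"
    then obtain h :: "'o \<Rightarrow> 'o" where h: "inj h" "range h \<subseteq> f ` A" by blast
    have "inj (g \<circ> inv_into A f \<circ> h)"
    proof (intro comp_inj_on)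
      show "inj_on (inv_into A f) (range h)"
        using h(2) inj_on_inv_into by blast
      have "inv_into A f ` range h \<subseteq> A"
        using h(2) by (metis image_subset_iff inv_into_into subset_iff)
      then show "inj_on g (inv_into A f ` range h)"
        using assms(1) inj_on_subset by blast
    qed (rule h(1))
    moreover have "range (g \<circ> inv_into A f \<circ> h) \<subseteq> {b. b < a}"
    proof
      fix y assume "y \<in> range (g \<circ> inv_into A f \<circ> h)"
      then obtain x where x: "y = g (inv_into A f (h x))" by auto
      have "h x \<in> f ` A" using h(2) by blast
      then have "inv_into A f (h x) \<in> A" by (rule inv_into_into)
      then show "y \<in> {b. b < a}" using assms(2) x by auto
    qed
    ultimately have "\<not> small_set {b. b < a}"
      unfolding small_set_def by blast
    then show False using regular unfolding regular_ordinal_type_def by blast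
  qed
  from small_imp_bounded [OF this] show ?thesis by blast
qed

lemma bounded_image_lessThan: "\<exists>b. \<forall>x<a::'o. (f x :: 'o) < b"
  using bounded_image_of_injection [of id "{..<a}" a f] by auto

lemma no_maximum: "\<exists>b. (x::'o) < b"
proof -
  obtain z where "z < a0" using infinite_a0 by (metis finite.emptyI equals0I lessThan_iff)
  \<comment> \<open>A constant function on the nonempty segment below \<open>a0\<close> has a strict
    bound.\<close>
  then show ?thesis using bounded_image_lessThan [of a0 "\<lambda>_. x"] by blast
qed

lemma osucc_le_iff: "osucc x \<le> y \<longleftrightarrow> x < (y::'o)"
proof
  obtain b where "x < b" using no_maximum by blast
  then have "x < osucc x" unfolding osucc_def by (rule LeastI)
  then show "osucc x \<le> y \<Longrightarrow> x < y" by simp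
  show "x < y \<Longrightarrow> osucc x \<le> y" unfolding osucc_def by (rule Least_le)
qed

lemma less_osucc: "x < osucc (x::'o)"
  using osucc_le_iff by blast

lemma less_osucc_iff: "x < osucc y \<longleftrightarrow> x \<le> (y::'o)"
  by (metis osucc_le_iff not_less)

definition one :: 'o where "one = osucc ozero"

lemma less_one_iff: "x < one \<longleftrightarrow> x = ozero"
  unfolding one_def less_osucc_iff by (simp add: order.antisym)

lemma wf_pair_below: "wf (pair_below :: (('o \<times> 'o) \<times> ('o \<times> 'o)) set)"
proof (rule wf_subset)
  show "wf ({(x, y::'o). x < y} <*lex*> {(x, y::'o). x < y})"
    using wf by (rule wf_lex_prod) (rule wf)
  show "pair_below \<subseteq> {(x, y::'o). x < y} <*lex*> {(x, y::'o). x < y}"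
    unfolding pair_below_def by auto
qed

section \<open>Recursion and algebra of the natural sum\<close>

lemma nsum_unfold:
  "nsum a b = (LEAST c::'o. (\<forall>x<a. nsum x b < c) \<and> (\<forall>y<b. nsum a y < c))"
proof -
  define F where "F = (\<lambda>f (x::'o, y::'o). LEAST c::'o. (\<forall>x'<x. f (x', y) < c) \<and> (\<forall>y'<y. f (x, y') < c))"
  have *: "nsum x y = wfrec pair_below F (x, y)" for x y
    unfolding nsum_def F_def ..
  have "wfrec pair_below F (a, b) = F (cut (wfrec pair_below F) pair_below (a, b)) (a, b)"
    by (rule wfrec [OF wf_pair_below])
  moreover have "cut (wfrec pair_below F) pair_below (a, b) (x, b) = nsum x b" if "x < a" for x
    using that unfolding * by (intro cut_apply) (auto simp: pair_below_def)
  moreover have "cut (wfrec pair_below F) pair_below (a, b) (a, y) = nsum a y" if "y < b" for y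
    using that unfolding * by (intro cut_apply) (auto simp: pair_below_def)
  ultimately show ?thesis
    unfolding * [of a b] by (simp add: F_def cong: conj_cong)
qed

text \<open>Regularity provides some ordinal satisfying the condition, so the \<open>LEAST\<close>
  in \<open>nsum_unfold\<close> is attained.\<close>

lemma nsum_bounds: "(\<forall>x<a. nsum x b < nsum a b) \<and> (\<forall>y<b. nsum a y < nsum a (b::'o))"
proof -
  obtain c1 where c1: "\<forall>x<a. nsum x b < c1" using bounded_image_lessThan [of a "\<lambda>x. nsum x b"] by blast
  obtain c2 where c2: "\<forall>y<b. nsum a y < c2" using bounded_image_lessThan [of b "\<lambda>y. nsum a y"] by blast
  have "(\<forall>x<a. nsum x b < max c1 c2) \<and> (\<forall>y<b. nsum a y < max c1 c2)"
    using c1 c2 by (auto simp: less_max_iff_disj)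
  then show ?thesis
    by (subst (2 4) nsum_unfold) (rule LeastI)
qed

lemma nsum_less_left: "x < y \<Longrightarrow> nsum x b < nsum y (b::'o)"
  using nsum_bounds by blast

lemma nsum_less_right: "x < y \<Longrightarrow> nsum a x < nsum a (y::'o)"
  using nsum_bounds by blast

lemma nsum_mono: "a \<le> a' \<Longrightarrow> b \<le> b' \<Longrightarrow> nsum a b \<le> nsum a' (b'::'o)"
  using nsum_less_left [of a a' b] nsum_less_right [of b b' a']
  by (fastforce simp: order.order_iff_strict)

lemma nsum_less_cancel_left: "nsum a x < nsum a y \<longleftrightarrow> x < (y::'o)"
  using nsum_less_right [of x y a] nsum_less_right [of y x a] by (cases x y rule: linorder_cases) auto

lemma nsum_le_cancel_left: "nsum a x \<le> nsum a y \<longleftrightarrow> x \<le> (y::'o)"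
  by (simp add: nsum_less_cancel_left flip: not_less)

lemma nsum_le_cancel_right: "nsum x a \<le> nsum y a \<longleftrightarrow> x \<le> (y::'o)"
  using nsum_less_left [of x y a] nsum_less_left [of y x a] by (cases x y rule: linorder_cases) auto

text \<open>Minimality of the sum: a smaller ordinal is still reached after one summand is lowered.
  Later inequalities between sums rest on this rule and on strict monotonicity.\<close>

lemma less_nsumE:
  assumes "z < nsum a (b::'o)"
  obtains (left) x where "x < a" "z \<le> nsum x b" | (right) y where "y < b" "z \<le> nsum a y"
proof -
  have "\<not> ((\<forall>x<a. nsum x b < z) \<and> (\<forall>y<b. nsum a y < z))"
    using assms by (subst (asm) nsum_unfold) (rule not_less_Least)
  then show ?thesis using that by (meson not_less)
qed

text \<open>If the sums differed, \<open>less_nsumE\<close> would lower one summand of the larger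
  sum; the induction hypothesis swaps the summands there, and strict monotonicity gives a
  contradiction. Associativity is proved in the same way.\<close>

lemma nsum_commute: "nsum a b = nsum b (a::'o)"
proof (induction a arbitrary: b rule: less_induct)
  case (less a)
  note IHa = less.IH
  show ?case
  proof (induction b rule: less_induct)
    case (less b)
    show ?case
    proof (rule ccontr)
      assume "nsum a b \<noteq> nsum b a"
      then consider "nsum b a < nsum a b" | "nsum a b < nsum b a" by fastforce
      then show False
      proof cases
        case 1
        then show False
          by (cases rule: less_nsumE)
            (use IHa less.IH nsum_less_left nsum_less_right in \<open>metis leD\<close>)+
      next
        case 2
        then show False
          by (cases rule: less_nsumE)
            (use IHa less.IH nsum_less_left nsum_less_right in \<open>metis leD\<close>)+
      qed
    qed
  qed
qed

lemma nsum_ozero: "nsum a ozero = (a::'o)"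
proof (induction a rule: less_induct)
  case (less a)
  have "a \<le> nsum a ozero"
  proof (rule ccontr)
    assume "\<not> a \<le> nsum a ozero"
    then have "nsum a ozero < a" by simp
    then show False using less nsum_less_left [of "nsum a ozero" a ozero] by fastforce
  qed
  moreover have "\<not> a < nsum a ozero"
  proof
    assume "a < nsum a ozero"
    then show False
      by (cases rule: less_nsumE) (use less in auto)
  qed
  ultimately show ?case by simp
qed

lemma nsum_assoc: "nsum (nsum a b) c = nsum a (nsum b (c::'o))"
proof (induction a arbitrary: b c rule: less_induct)
  case (less a)
  note IHa = less.IH
  show ?case
  proof (induction b arbitrary: c rule: less_induct)
    case (less b)
    note IHb = less.IH
    show ?case
    proof (induction c rule: less_induct)
      case (less c)
      note IHc = less.IH
      show ?case
      proof (rule ccontr)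
        assume "nsum (nsum a b) c \<noteq> nsum a (nsum b c)"
        then consider "nsum a (nsum b c) < nsum (nsum a b) c" | "nsum (nsum a b) c < nsum a (nsum b c)"
          by fastforce
        then show False
        proof cases
          case 1
          then show False
          proof (cases rule: less_nsumE)
            case (left x)
            from left(1) show False
            proof (cases rule: less_nsumE)
              case (left a')
              then have "nsum x c \<le> nsum a' (nsum b c)" using IHa by (metis nsum_mono order_refl)
              then show False using \<open>nsum a (nsum b c) \<le> nsum x c\<close> nsum_less_left [OF left(1)]
                by (meson leD order.trans)
            next
              case (right b')
              then have "nsum x c \<le> nsum a (nsum b' c)" using IHb by (metis nsum_mono order_refl)
              then show False using \<open>nsum a (nsum b c) \<le> nsum x c\<close>
                  nsum_less_right [OF nsum_less_left [OF right(1)]] by (meson leD order.trans)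
            qed
          next
            case (right c')
            then show False using IHc nsum_less_right [OF nsum_less_right [OF right(1)]]
              by (metis leD)
          qed
        next
          case 2
          then show False
          proof (cases rule: less_nsumE)
            case (left a')
            then show False using IHa nsum_less_left [OF nsum_less_left [OF left(1)]] by (metis leD)
          next
            case (right x)
            from right(1) show False
            proof (cases rule: less_nsumE)
              case (left b')
              then have "nsum a x \<le> nsum (nsum a b') c" using IHb by (metis nsum_mono order_refl)
              then show False using \<open>nsum (nsum a b) c \<le> nsum a x\<close>
                  nsum_less_left [OF nsum_less_right [OF left(1)]] by (meson leD order.trans)
            next
              case (right c')
              then have "nsum a x \<le> nsum (nsum a b) c'" using IHc by (metis nsum_mono order_refl)
              then show False using \<open>nsum (nsum a b) c \<le> nsum a x\<close>
                  nsum_less_right [OF right(1)] by (meson leD order.trans)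
            qed
          qed
        qed
      qed
    qed
  qed
qed

sublocale nsums: comm_monoid_set "nsum :: 'o \<Rightarrow> 'o \<Rightarrow> 'o" ozero
  by unfold_locales (fact nsum_assoc nsum_commute nsum_ozero)+

lemma nsum_ge_left: "a \<le> nsum a (b::'o)"
  using nsum_mono [OF order_refl ozero_le, of a b] by (simp add: nsum_ozero)

lemma nsum_ge_right: "b \<le> nsum a (b::'o)"
  using nsum_ge_left [of b a] by (simp only: nsum_commute)

lemma nsum_one: "nsum a one = osucc a"
proof (induction a rule: less_induct)
  case (less a)
  have "a < nsum a one"
    using nsum_less_right [of ozero one a] less_osucc by (simp add: nsum_ozero one_def)
  moreover have "\<not> osucc a < nsum a one"
  proof
    assume "osucc a < nsum a one"
    then show False
    proof (cases rule: less_nsumE)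
      case (left x)
      then show False using less by (metis leD less_osucc osucc_le_iff order.trans)
    next
      case (right y)
      then show False using osucc_le_iff by (simp add: less_one_iff nsum_ozero)
    qed
  qed
  ultimately show ?case by (simp add: order.antisym osucc_le_iff)
qed

section \<open>Finite multiples and sums of finite families\<close>

primrec nmul :: "nat \<Rightarrow> 'o \<Rightarrow> 'o" where
  "nmul 0 a = ozero"
| "nmul (Suc k) a = nsum (nmul k a) a"

lemma nmul_add: "nmul (k + l) a = nsum (nmul k a) (nmul l a)"
  by (induction l) (simp_all add: nsum_ozero nsum_assoc)

lemma nmul_mult: "nmul (k * l) a = nmul k (nmul l a)"
  by (induction k) (simp_all add: nmul_add nsum_commute)

lemma nmul_mono: "a \<le> b \<Longrightarrow> nmul k a \<le> nmul k b"
  by (induction k) (simp_all add: nsum_mono)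

lemma nmul_strict_mono: "0 < k \<Longrightarrow> a < b \<Longrightarrow> nmul k a < nmul k b"
  using nsum_less_right [of a b "nmul (k - 1) a"]
    nsum_mono [OF nmul_mono [OF order.strict_implies_order, of a b "k - 1"] order_refl, of b]
  by (cases k) auto

lemma nmul_mono_left: "k \<le> l \<Longrightarrow> nmul k a \<le> nmul l a"
  by (metis le_Suc_ex nmul_add nsum_ge_left)

lemma nsums_const: "finite S \<Longrightarrow> nsums.F (\<lambda>_. a) S = nmul (card S) a"
  by (induction S rule: finite_induct) (simp_all add: nsum_commute)

lemma nsums_mono: "(\<And>x. x \<in> S \<Longrightarrow> f x \<le> g x) \<Longrightarrow> nsums.F f S \<le> nsums.F g S"
  by (induction S rule: infinite_finite_induct) (simp_all add: nsum_mono)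

lemma nsums_subset:
  assumes "finite T" "S \<subseteq> T" shows "nsums.F f S \<le> nsums.F f T"
  using nsums.subset_diff [OF assms(2,1)] nsum_ge_right by metis

lemma nsums_strict_mono:
  assumes "finite S" "d \<in> S" "f d < g d" "\<And>x. x \<in> S \<Longrightarrow> f x \<le> g x"
  shows "nsums.F f S < nsums.F g S"
proof -
  have "nsums.F f (S - {d}) \<le> nsums.F g (S - {d})" using assms(4) by (intro nsums_mono) auto
  then show ?thesis
    unfolding nsums.remove [OF assms(1,2)]
    by (rule order.strict_trans2 [OF nsum_less_left [OF assms(3)] nsum_mono [OF order_refl]])
qed

text \<open>The family version of \<open>less_nsumE\<close>: the loss can be located in a single
  summand.\<close>

lemma less_nsumsE:
  assumes "finite S" "z < nsums.F f S"
  obtains d x where "d \<in> S" "x < f d" "z \<le> nsum (nsums.F f (S - {d})) x"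
proof -
  have "\<exists>d\<in>S. \<exists>x<f d. z \<le> nsum (nsums.F f (S - {d})) x"
    using assms
  proof (induction S arbitrary: z rule: finite_induct)
    case (insert e S)
    from insert.prems have "z < nsum (f e) (nsums.F f S)" using insert.hyps by simp
    then show ?case
    proof (cases rule: less_nsumE)
      case (left x)
      then show ?thesis using insert.hyps
        by (metis insertI1 Diff_insert_absorb nsum_commute)
    next
      case (right y)
      then obtain d x where d: "d \<in> S" "x < f d" "y \<le> nsum (nsums.F f (S - {d})) x"
        using insert.IH by blast
      have "insert e S - {d} = insert e (S - {d})" using d insert.hyps by auto
      then have "nsums.F f (insert e S - {d}) = nsum (f e) (nsums.F f (S - {d}))"
        using insert.hyps by simp
      then have "z \<le> nsum (nsums.F f (insert e S - {d})) x"
        using order.trans [OF right(2) nsum_mono [OF order_refl d(3)]] by (simp add: nsum_assoc)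
      then show ?thesis using d by blast
    qed
  qed simp
  then show ?thesis using that by blast
qed

section \<open>Natural products with finite ordinals\<close>

lemma nprod_unfold:
  "nprod a b = (LEAST c::'o. \<forall>x<a. \<forall>y<b. nsum (nprod x b) (nprod a y) < nsum c (nprod x y))"
proof -
  define F where "F = (\<lambda>f (x::'o, y::'o). LEAST c::'o. \<forall>x'<x. \<forall>y'<y.
         nsum (f (x', y)) (f (x, y')) < nsum c (f (x', y')))"
  have *: "nprod x y = wfrec pair_below F (x, y)" for x y
    unfolding nprod_def F_def ..
  have "wfrec pair_below F (a, b) = F (cut (wfrec pair_below F) pair_below (a, b)) (a, b)"
    by (rule wfrec [OF wf_pair_below])
  moreover have "cut (wfrec pair_below F) pair_below (a, b) (x, y) = nprod x y"
    if "x \<le> a" "y \<le> b" "x < a \<or> y < b" for x y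
    using that unfolding * by (intro cut_apply) (auto simp: pair_below_def)
  ultimately show ?thesis
    unfolding * [of a b] by (simp add: F_def)
qed

lemma ofnat_Suc: "ofnat (Suc k) = osucc (ofnat k :: 'o)"
  by (simp add: ofnat_def)

lemma less_ofnatE:
  assumes "y < (ofnat k :: 'o)" obtains j where "j < k" "y = ofnat j"
proof -
  have "\<exists>j<k. y = ofnat j" using assms
  proof (induction k)
    case (Suc k)
    then show ?case unfolding ofnat_Suc less_osucc_iff using less_Suc_eq by fastforce
  qed (simp add: ofnat_def)
  then show ?thesis using that by blast
qed

lemma ofnat_less: "j < k \<Longrightarrow> ofnat j < (ofnat k :: 'o)"
  by (induction k) (auto simp: ofnat_Suc less_osucc_iff less_Suc_eq)

text \<open>For finite \<open>b\<close>, the term \<open>nmul j x\<close> cancels on both sides of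
  Conway's condition. What remains asks that \<open>c\<close> exceed the sum of
  \<open>nmul (k - j) x\<close> and \<open>nmul j a\<close>, and \<open>nmul k a\<close> is the
  least such \<open>c\<close>.\<close>

lemma nprod_ofnat: "nprod a (ofnat k) = nmul k a"
proof (induction k arbitrary: a rule: less_induct)
  case (less k)
  note IHk = less.IH
  show ?case
  proof (induction a rule: less_induct)
    case (less a)
    have step: "nsum (nmul k x) (nmul j a) < nsum c (nmul j x) \<longleftrightarrow> nsum (nmul (k - j) x) (nmul j a) < c"
      if "j < k" for x j c
    proof -
      have "nsum (nmul k x) (nmul j a) = nsum (nmul j x) (nsum (nmul (k - j) x) (nmul j a))"
        using that nmul_add [of j "k - j" x] by (simp add: nsum_assoc)
      moreover have "nsum c (nmul j x) = nsum (nmul j x) c" by (rule nsum_commute)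
      ultimately show ?thesis by (simp only: nsum_less_cancel_left)
    qed
    have "nprod a (ofnat k) = (LEAST c. \<forall>x<a. \<forall>j<k. nsum (nmul (k - j) x) (nmul j a) < c)"
    proof (subst nprod_unfold, rule arg_cong [where f = Least], rule ext)
      fix c
      have "(\<forall>x<a. \<forall>y<ofnat k. nsum (nprod x (ofnat k)) (nprod a y) < nsum c (nprod x y)) \<longleftrightarrow>
        (\<forall>x<a. \<forall>j<k. nsum (nprod x (ofnat k)) (nprod a (ofnat j)) < nsum c (nprod x (ofnat j)))"
        by (metis less_ofnatE ofnat_less)
      also have "\<dots> \<longleftrightarrow> (\<forall>x<a. \<forall>j<k. nsum (nmul (k - j) x) (nmul j a) < c)"
        using IHk less.IH step by auto
      finally show "(\<forall>x<a. \<forall>y<ofnat k. nsum (nprod x (ofnat k)) (nprod a y) < nsum c (nprod x y)) =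
        (\<forall>x<a. \<forall>j<k. nsum (nmul (k - j) x) (nmul j a) < c)" .
    qed
    also have "\<dots> = nmul k a"
    proof (rule Least_equality)
      show "\<forall>x<a. \<forall>j<k. nsum (nmul (k - j) x) (nmul j a) < nmul k a"
      proof (intro allI impI)
        fix x j assume "x < a" "j < k"
        then have "nsum (nmul (k - j) x) (nmul j a) < nsum (nmul (k - j) a) (nmul j a)"
          by (intro nsum_less_left nmul_strict_mono) auto
        also have "\<dots> = nmul k a" using \<open>j < k\<close> by (simp flip: nmul_add)
        finally show "nsum (nmul (k - j) x) (nmul j a) < nmul k a" .
      qed
    next
      fix c assume c: "\<forall>x<a. \<forall>j<k. nsum (nmul (k - j) x) (nmul j a) < c"
      show "nmul k a \<le> c"
      proof (cases k)
        case (Suc l)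
        show ?thesis
        proof (rule ccontr)
          assume "\<not> nmul k a \<le> c"
          then have "c < nsums.F (\<lambda>_. a) {..<k}" by (simp add: nsums_const)
          then obtain d x where d: "d \<in> {..<k}" "x < a" "c \<le> nsum (nsums.F (\<lambda>_. a) ({..<k} - {d})) x"
            by (rule less_nsumsE [rotated]) auto
          then have "c \<le> nsum (nmul l a) x" using Suc by (simp add: nsums_const)
          \<comment> \<open>The critical instance is \<open>j = l\<close>, that is
            \<open>k - 1\<close>, where only one of the \<open>k\<close> summands is
            lowered.\<close>
          moreover have "nsum (nmul (k - l) x) (nmul l a) < c" using c d(2) Suc by blast
          ultimately show False using Suc by (simp add: nsum_commute nsum_ozero)
        qed
      qed simp
    qed
    finally show ?case .
  qed
qed

lemma foldl_nprod_ofnat: "foldl nprod w (map ofnat ks) = nmul (prod_list ks) w"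
  by (induction ks arbitrary: w)
    (simp_all add: nprod_ofnat nsum_ozero nsum_commute mult.commute flip: nmul_mult)

section \<open>Indecomposable ordinals\<close>

text \<open>These are the powers of \<omega>, including \<open>one\<close>, characterized by closure
  under the natural sum.\<close>

definition indecomposable :: "'o \<Rightarrow> bool" where
  "indecomposable v \<longleftrightarrow> ozero < v \<and> (\<forall>x<v. \<forall>y<v. nsum x y < v)"

lemma indecomposable_nsum: "indecomposable v \<Longrightarrow> x < v \<Longrightarrow> y < v \<Longrightarrow> nsum x y < v"
  by (simp add: indecomposable_def)

lemma indecomposable_pos: "indecomposable v \<Longrightarrow> ozero < v"
  by (simp add: indecomposable_def)

lemma indecomposable_one: "indecomposable one"
  by (simp add: indecomposable_def less_one_iff nsum_ozero)

lemma indecomposable_one_le: "indecomposable v \<Longrightarrow> one \<le> v"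
  by (simp add: indecomposable_def one_def osucc_le_iff)

lemma indecomposable_nmul: "indecomposable v \<Longrightarrow> x < v \<Longrightarrow> nmul k x < v"
  by (induction k) (simp_all add: indecomposable_nsum indecomposable_pos)

text \<open>An ordinal below the sum leaves room in one summand \<open>v d\<close>, and that room
  absorbs \<open>c\<close> because \<open>v d\<close> is indecomposable.\<close>

lemma nsums_absorb:
  assumes "finite S" "\<And>d. d \<in> S \<Longrightarrow> indecomposable (v d) \<and> c < v d" "z < nsums.F v S"
  shows "nsum z c < nsums.F v S"
proof -
  from assms(1,3) obtain d x where d: "d \<in> S" "x < v d" "z \<le> nsum (nsums.F v (S - {d})) x"
    by (rule less_nsumsE)
  have "nsum z c \<le> nsum (nsum (nsums.F v (S - {d})) x) c"
    using d(3) by (simp add: nsum_mono)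
  also have "\<dots> < nsum (nsums.F v (S - {d})) (v d)"
    unfolding nsum_assoc using assms(2) d by (intro nsum_less_right indecomposable_nsum) auto
  also have "\<dots> = nsums.F v S"
    using nsums.remove [OF assms(1) d(1), of v] by (simp add: nsum_commute)
  finally show ?thesis .
qed

text \<open>With \<open>u\<close> least among the summands, any loss can be charged to
  \<open>u\<close>: a loss in an equal summand is exchanged with \<open>u\<close>, and a loss in a
  larger one absorbs \<open>u\<close> entirely. Thus a natural sum in nonincreasing order behaves
  like the ordinary sum.\<close>

lemma less_nsums_indecomposableE:
  assumes "finite S" "\<And>d. d \<in> S \<Longrightarrow> indecomposable (v d) \<and> u \<le> v d" "indecomposable u"
    and "z < nsum (nsums.F v S) u"
  obtains c where "c < u" "z \<le> nsum (nsums.F v S) c"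
  using assms(4)
proof (cases rule: less_nsumE)
  case (left x)
  from assms(1) left(1) obtain d y where d: "d \<in> S" "y < v d" "x \<le> nsum (nsums.F v (S - {d})) y"
    by (rule less_nsumsE)
  have S: "nsums.F v S = nsum (nsums.F v (S - {d})) (v d)"
    using nsums.remove [OF assms(1) d(1), of v] by (simp add: nsum_commute)
  have z: "z \<le> nsum (nsums.F v (S - {d})) (nsum y u)"
    using order.trans [OF left(2) nsum_mono [OF d(3) order_refl]] by (simp add: nsum_assoc)
  show ?thesis
  proof (cases "u = v d")
    case True
    then have "z \<le> nsum (nsums.F v S) y" using z unfolding S by (simp add: nsum_assoc nsum_commute)
    then show ?thesis using that d True by blast
  next
    case False
    then have "u < v d" using assms(2) [OF d(1)] by (simp add: order.not_eq_order_implies_strict)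
    then have "nsum y u < v d" using assms(2) [OF d(1)] d(2) by (simp add: indecomposable_nsum)
    then have "z \<le> nsums.F v S" using z nsum_less_right unfolding S
      by (meson order.strict_implies_order order.trans)
    then show ?thesis using that [of ozero] assms(3) by (simp add: indecomposable_pos nsum_ozero)
  qed
qed (use that in blast)

text \<open>Among the pairs below \<open>a\<close> with sum at least \<open>a\<close>, take one
  minimal in \<open>pair_below\<close>; a strict excess would allow one summand to be
  lowered.\<close>

lemma decomposable_split:
  assumes "a \<noteq> ozero" "\<not> indecomposable a"
  obtains x y where "x < a" "y < a" "a = nsum x y"
proof -
  define Q where "Q = {(x, y). x < a \<and> y < a \<and> a \<le> nsum x y}"
  have "ozero < a" using assms(1) by (simp add: order.not_eq_order_implies_strict)
  then obtain x y where "(x, y) \<in> Q" using assms(2) by (auto simp: indecomposable_def Q_def not_less)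
  then obtain p where p: "p \<in> Q" and min: "\<And>q. (q, p) \<in> pair_below \<Longrightarrow> q \<notin> Q"
    using wfE_min [OF wf_pair_below] by metis
  obtain x y where xy: "p = (x, y)" by fastforce
  have "\<not> a < nsum x y"
  proof
    assume "a < nsum x y"
    then show False
    proof (cases rule: less_nsumE)
      case (left x')
      then show False using p min [of "(x', y)"] unfolding xy Q_def pair_below_def by fastforce
    next
      case (right y')
      then show False using p min [of "(x, y')"] unfolding xy Q_def pair_below_def by fastforce
    qed
  qed
  then show ?thesis using that p unfolding xy Q_def by auto
qed

section \<open>Existence of Cantor normal forms\<close>

lemma foldr_nsum_append: "foldr nsum (xs @ ys) ozero = nsum (foldr nsum xs ozero) (foldr nsum ys (ozero::'o))"
  by (induction xs) (simp_all add: nsum_assoc)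

lemma foldr_nsum_sort: "foldr nsum (sort xs) ozero = foldr nsum xs (ozero::'o)"
proof (induction xs)
  case (Cons x xs)
  have "foldr nsum (insort x ys) ozero = nsum x (foldr nsum ys ozero)" for ys
    by (induction ys) (simp_all add: nsums.left_commute)
  then show ?case using Cons by simp
qed simp

lemma foldr_nsum_rev: "foldr nsum xs ozero = nsums.F (\<lambda>j. rev xs ! j) {..<length xs}"
proof (induction xs)
  case (Cons x xs)
  have "nsums.F (\<lambda>j. rev (x # xs) ! j) {..<length xs} = nsums.F (\<lambda>j. rev xs ! j) {..<length xs}"
    by (rule nsums.cong) (auto simp: nth_append)
  then show ?case using Cons by (simp add: lessThan_Suc nth_append)
qed simp

lemma indecomposable_summands:
  "\<exists>xs. (\<forall>x\<in>set xs. indecomposable x) \<and> foldr nsum xs ozero = a"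
proof (induction a rule: less_induct)
  case (less a)
  show ?case
  proof (cases "a = ozero \<or> indecomposable a")
    case True
    then show ?thesis
      by (elim disjE) (rule exI [of _ "[]"], simp, rule exI [of _ "[a]"], simp add: nsum_ozero)
  next
    case False
    then obtain x y where xy: "x < a" "y < a" "a = nsum x y" using decomposable_split by blast
    obtain xs ys where "\<forall>x\<in>set xs. indecomposable x" "foldr nsum xs ozero = x"
      "\<forall>x\<in>set ys. indecomposable x" "foldr nsum ys ozero = y"
      using less xy by blast
    then show ?thesis using xy by (intro exI [of _ "xs @ ys"]) (auto simp: foldr_nsum_append simp del: foldr_append)
  qed
qed

text \<open>The summands are the terms of the Cantor normal form.\<close>

definition normal_form :: "(nat \<Rightarrow> 'o) \<Rightarrow> nat \<Rightarrow> bool" where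
  "normal_form v r \<longleftrightarrow> (\<forall>j<r. indecomposable (v j)) \<and> (\<forall>i j. i \<le> j \<longrightarrow> j < r \<longrightarrow> v j \<le> v i)"

lemma normal_form_exists: "\<exists>v r. normal_form v r \<and> a = nsums.F v {..<r}"
proof -
  obtain xs where xs: "\<forall>x\<in>set xs. indecomposable x" "foldr nsum xs ozero = a"
    using indecomposable_summands by blast
  define ys where "ys = sort xs"
  \<comment> \<open>\<open>sort\<close> is increasing, so reversing puts the largest term at index
    \<open>0\<close>.\<close>
  have "normal_form (\<lambda>j. rev ys ! j) (length ys)"
    unfolding normal_form_def
  proof (intro conjI allI impI)
    fix j assume "j < length ys"
    then have "rev ys ! j \<in> set ys" by (metis length_rev nth_mem set_rev)
    then show "indecomposable (rev ys ! j)" using xs by (simp add: ys_def)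
  next
    fix i j assume "i \<le> j" "j < length ys"
    then show "rev ys ! j \<le> rev ys ! i"
      by (simp add: rev_nth sorted_nth_mono ys_def)
  qed
  moreover have "a = nsums.F (\<lambda>j. rev ys ! j) {..<length ys}"
    using xs(2) foldr_nsum_rev [of ys] foldr_nsum_sort [of xs] unfolding ys_def by metis
  ultimately show ?thesis by blast
qed

lemma normal_form_indecomposable: "normal_form v r \<Longrightarrow> j < r \<Longrightarrow> indecomposable (v j)"
  by (simp add: normal_form_def)

lemma normal_form_antimono: "normal_form v r \<Longrightarrow> i \<le> j \<Longrightarrow> j < r \<Longrightarrow> v j \<le> v i"
  by (simp add: normal_form_def)

section \<open>Blocks of a normal form\<close>

lemma nsums_Suc: "nsums.F v {..<Suc j} = nsum (nsums.F v {..<j}) (v j)"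
  by (simp add: lessThan_Suc nsum_commute)

lemma nsums_lessThan_mono: "i \<le> j \<Longrightarrow> nsums.F v {..<i} \<le> nsums.F v {..<j::nat}"
  by (rule nsums_subset) auto

definition block :: "(nat \<Rightarrow> 'o) \<Rightarrow> nat \<Rightarrow> 'o set" where
  "block v j = {nsums.F v {..<j}..<nsums.F v {..<Suc j}}"

text \<open>Take the least offset \<open>x\<close> reaching \<open>b\<close>. If it overshot,
  lowering \<open>x\<close> would contradict minimality, and lowering the partial sum would, after
  absorption of \<open>x\<close>, place \<open>b\<close> below the start of the block.\<close>

lemma block_offset:
  assumes "normal_form v r" "j < r" "b \<in> block v j"
  obtains x where "x < v j" "b = nsum (nsums.F v {..<j}) x"
proof -
  have *: "indecomposable (v d) \<and> v j \<le> v d" if "d \<in> {..<j}" for d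
    using that assms normal_form_indecomposable normal_form_antimono by simp
  have b: "nsums.F v {..<j} \<le> b" "b < nsum (nsums.F v {..<j}) (v j)"
    using assms(3) unfolding block_def nsums_Suc by auto
  define x where "x = (LEAST x. b \<le> nsum (nsums.F v {..<j}) x)"
  obtain c where c: "c < v j" "b \<le> nsum (nsums.F v {..<j}) c"
    using less_nsums_indecomposableE [of "{..<j}" v "v j" b] * b(2)
      normal_form_indecomposable [OF assms(1,2)] by auto
  have x: "b \<le> nsum (nsums.F v {..<j}) x" unfolding x_def using c(2) by (rule LeastI)
  have "x \<le> c" unfolding x_def using c(2) by (rule Least_le)
  then have "x < v j" using c(1) by simp
  moreover have "\<not> b < nsum (nsums.F v {..<j}) x"
  proof
    assume "b < nsum (nsums.F v {..<j}) x"
    then show False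
    proof (cases rule: less_nsumE)
      case (left z)
      have "nsum z x < nsums.F v {..<j}"
        using * left \<open>x < v j\<close> by (intro nsums_absorb) (auto intro: order.strict_trans2)
      then show False using left b by simp
    next
      case (right y)
      then show False unfolding x_def using not_less_Least by blast
    qed
  qed
  ultimately show ?thesis using that x by (metis order.not_eq_order_implies_strict)
qed

lemma block_exists:
  assumes "b < nsums.F v {..<r}"
  obtains j where "j < r" "b \<in> block v j"
proof -
  have "\<exists>j<r. b \<in> block v j" using assms
  proof (induction r)
    case (Suc r)
    show ?case
    proof (cases "b < nsums.F v {..<r}")
      case True
      then show ?thesis using Suc.IH less_Suc_eq by blast
    next
      case False
      then show ?thesis using Suc.prems by (auto simp: block_def)
    qed
  qed simp
  then show ?thesis using that by blast
qed

lemma block_less: "b \<in> block v i \<Longrightarrow> c \<in> block v j \<Longrightarrow> i < j \<Longrightarrow> b < c"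
  using nsums_lessThan_mono [of "Suc i" j v] by (auto simp: block_def)

lemma block_one: "v j = one \<Longrightarrow> b \<in> block v j \<Longrightarrow> c \<in> block v j \<Longrightarrow> b = c"
  unfolding block_def nsums_Suc by (auto simp: nsum_one less_osucc_iff)

lemma block_nsum: "x < v j \<Longrightarrow> nsum (nsums.F v {..<j}) x \<in> block v j"
  unfolding block_def nsums_Suc by (auto simp: nsum_ge_left nsum_less_right)

lemma block_less_top: "b \<in> block v j \<Longrightarrow> j < r \<Longrightarrow> b < nsums.F v {..<r}"
  using nsums_lessThan_mono [of "Suc j" r v] by (auto simp: block_def)

text \<open>Finitely many offsets have a strict bound below \<open>v j\<close>, since
  \<open>v j\<close> is indecomposable and larger than \<open>one\<close>. Adding \<open>t\<close>
  to the offset \<open>x\<close> makes the estimate uniform in \<open>x\<close> and keeps the shift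
  an embedding.\<close>

lemma block_shift_exceeds:
  assumes "normal_form v r" "j < r" "one < v j" "finite G"
  obtains t where "t < v j" "\<And>g x. g \<in> G \<Longrightarrow> g \<in> block v j \<Longrightarrow> g < nsum (nsums.F v {..<j}) (nsum x t)"
proof -
  have ind: "indecomposable (v j)" using assms normal_form_indecomposable by blast
  have "\<exists>t<v j. \<forall>g\<in>G. g \<in> block v j \<longrightarrow> g < nsum (nsums.F v {..<j}) t"
    using assms(4)
  proof (induction G rule: finite_induct)
    case empty
    then show ?case using indecomposable_pos [OF ind] by auto
  next
    case (insert g G)
    then obtain t where t: "t < v j" "\<forall>g\<in>G. g \<in> block v j \<longrightarrow> g < nsum (nsums.F v {..<j}) t" by blast
    show ?case
    proof (cases "g \<in> block v j")
      case True
      then obtain y where y: "y < v j" "g = nsum (nsums.F v {..<j}) y"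
        using block_offset assms by blast
      have "nsum (max y t) one < v j" using y t ind assms by (simp add: indecomposable_nsum)
      moreover have "g < nsum (nsums.F v {..<j}) (nsum (max y t) one)"
        using y by (simp add: nsum_less_cancel_left nsum_one less_osucc_iff)
      moreover have "nsum (nsums.F v {..<j}) t \<le> nsum (nsums.F v {..<j}) (nsum (max y t) one)"
        unfolding nsum_le_cancel_left nsum_one by (metis less_osucc max.cobounded2 order.strict_implies_order order.trans)
      ultimately show ?thesis using t by (metis insert_iff order.strict_trans2)
    qed (use t in auto)
  qed
  then obtain t where t: "t < v j" "\<forall>g\<in>G. g \<in> block v j \<longrightarrow> g < nsum (nsums.F v {..<j}) t" by blast
  moreover have "nsum (nsums.F v {..<j}) t \<le> nsum (nsums.F v {..<j}) (nsum x t)" for x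
    by (simp add: nsum_le_cancel_left nsum_ge_right)
  ultimately show ?thesis using that by (meson order.strict_trans2)
qed

lemma finite_below_nmul_one: "finite {..<nmul k one}"
proof (induction k)
  case (Suc k)
  have "{..<nmul (Suc k) one} = insert (nmul k one) {..<nmul k one}"
    by (auto simp: nsum_one less_osucc_iff)
  then show ?case using Suc by simp
qed (simp add: lessThan_def)

text \<open>Were the leading term \<open>one\<close>, all terms would be, and the ordinal would be
  finite.\<close>

lemma normal_form_infinite:
  assumes "normal_form v r" "infinite {..<nsums.F v {..<r}}"
  shows "0 < r" "one < v 0"
proof -
  show "0 < r" using assms(2) by (cases r) (auto simp: lessThan_def)
  show "one < v 0"
  proof (rule ccontr)
    assume "\<not> one < v 0"
    then have "v j = one" if "j < r" for j
      using that normal_form_antimono [OF assms(1), of 0 j]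
        indecomposable_one_le [OF normal_form_indecomposable [OF assms(1) that]] by simp
    then have "nsums.F v {..<r} = nsums.F (\<lambda>_. one) {..<r}" by (intro nsums.cong) auto
    then show False using assms(2) finite_below_nmul_one by (simp add: nsums_const)
  qed
qed

text \<open>Take for \<open>u\<close> the leading term and for \<open>k\<close> the number of terms
  of the normal form of \<open>d\<close>.\<close>

lemma le_nmul_indecomposable:
  assumes "d \<noteq> ozero"
  obtains u k where "indecomposable u" "u \<le> d" "d \<le> nmul k u"
proof -
  obtain v r where v: "normal_form v r" "d = nsums.F v {..<r}" using normal_form_exists by blast
  have r: "0 < r" using assms v(2) by (cases r) auto
  show ?thesis
  proof (rule that [of "v 0" r])
    show "indecomposable (v 0)" using v r by (simp add: normal_form_indecomposable)
    show "v 0 \<le> d" using nsums_subset [of "{..<r}" "{0}" v] r v(2) by (simp add: nsum_ozero)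
    have "nsums.F v {..<r} \<le> nsums.F (\<lambda>_. v 0) {..<r}"
      using v(1) by (intro nsums_mono) (simp add: normal_form_antimono)
    then show "d \<le> nmul r (v 0)" using v(2) by (simp add: nsums_const)
  qed
qed

section \<open>Bounds for widths\<close>

text \<open>This cardinality bound survives products and finite sequences because \<open>a0\<close>
  is infinite, so it passes from \<open>A\<close> to the forest over \<open>A\<close>.\<close>

definition small :: "'x set \<Rightarrow> bool" where
  "small A \<longleftrightarrow> (card_of A, card_of {..<a0}) \<in> ordLeq"

lemma small_subset: "small A \<Longrightarrow> B \<subseteq> A \<Longrightarrow> small B"
  unfolding small_def using card_of_mono1 ordLeq_transitive by blast

lemma small_Times: "small A \<Longrightarrow> small B \<Longrightarrow> small (A \<times> B)"
  unfolding small_def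
  using infinite_a0 by (intro card_of_Times_ordLeq_infinite_Field card_of_Card_order) (simp_all add: Field_card_of)

lemma small_image: "small A \<Longrightarrow> small (f ` A)"
  unfolding small_def using card_of_image ordLeq_transitive by blast

lemma small_countable_UN: "(\<And>n::nat. small (A n)) \<Longrightarrow> small (\<Union>n. A n)"
  unfolding small_def
  using infinite_a0 by (intro card_of_UNION_ordLeq_infinite) (auto simp flip: infinite_iff_card_of_nat)

lemma small_finite: "finite A \<Longrightarrow> small A"
  unfolding small_def
  using ordLeq_total [OF card_of_Well_order [of A] card_of_Well_order [of "{..<a0}"]]
    card_of_ordLeq_infinite [OF _ infinite_a0, of A] by blast

lemma small_lists:
  assumes "small A" shows "small (lists A)"
proof -
  have "small {xs. set xs \<subseteq> A \<and> length xs = n}" for n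
  proof (induction n)
    case (Suc n)
    show ?case unfolding lists_length_Suc_eq by (intro small_image small_Times Suc assms)
  qed (simp add: small_finite)
  then have "small (\<Union>n. {xs. set xs \<subseteq> A \<and> length xs = n})" by (rule small_countable_UN)
  then show ?thesis by (rule small_subset) auto
qed

lemma bounded_image_small:
  assumes "small A" shows "\<exists>b. \<forall>x\<in>A. (f x :: 'o) < b"
proof -
  obtain g where "inj_on g A" "g ` A \<subseteq> {..<a0}"
    using assms unfolding small_def card_of_ordLeq [symmetric] by blast
  then show ?thesis by (rule bounded_image_of_injection)
qed

text \<open>The bound \<open>b\<close> guarantees that the \<open>LEAST\<close> in
  \<open>osup\<close> is attained.\<close>

lemma osup_upper: "s \<in> S \<Longrightarrow> \<forall>s\<in>S. s \<le> b \<Longrightarrow> s \<le> (osup S :: 'o)"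
  unfolding osup_def by (rule LeastI2) auto

lemma osup_least: "\<forall>s\<in>S. s \<le> b \<Longrightarrow> osup S \<le> (b::'o)"
  unfolding osup_def by (rule Least_le)

text \<open>Smallness bounds the suprema in the rank, the antichain condition makes the forest
  well-founded, and both pass to residuals.\<close>

definition narrow :: "('x \<Rightarrow> 'x \<Rightarrow> bool) \<Rightarrow> 'x set \<Rightarrow> bool" where
  "narrow le A \<longleftrightarrow> (\<forall>x\<in>A. le x x) \<and> small A \<and> no_infinite_antichain le A"

lemma narrow_subset: "narrow le A \<Longrightarrow> B \<subseteq> A \<Longrightarrow> narrow le B"
  unfolding narrow_def using small_subset no_infinite_antichain_subset by blast

lemma narrow_apart: "narrow le A \<Longrightarrow> narrow le (apart le A F)"
  by (rule narrow_subset [OF _ apart_subset])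

section \<open>The width recursion\<close>

abbreviation W :: "('x \<Rightarrow> 'x \<Rightarrow> bool) \<Rightarrow> 'x set \<Rightarrow> 'o" where
  "W le A \<equiv> width A le"

lemma W_apart_seq_less:
  assumes "narrow le A" "s \<in> inc_seqs A le"
  shows "W le (apart le A (set s)) < W le A"
proof -
  let ?S = "{osucc (W le (apart le A (set s))) | s. s \<in> inc_seqs A le}"
  have "small (inc_seqs A le)"
    using assms(1) unfolding narrow_def
    by (intro small_subset [OF small_lists [of A]]) (auto simp: inc_seqs_def)
  from bounded_image_small [OF this] obtain b
    where "\<forall>s\<in>inc_seqs A le. osucc (W le (apart le A (set s))) < b" ..
  then have "\<forall>s\<in>?S. s \<le> b" by (auto intro: order.strict_implies_order)
  moreover have "osucc (W le (apart le A (set s))) \<in> ?S" using assms(2) by blast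
  ultimately have "osucc (W le (apart le A (set s))) \<le> osup ?S" by (intro osup_upper)
  then show ?thesis
    using assms(1) unfolding narrow_def by (subst width_eq_osup [of le A]) (auto simp: osucc_le_iff)
qed

lemma W_apart_less: "narrow le A \<Longrightarrow> x \<in> A \<Longrightarrow> W le (apart le A {x}) < W le A"
  using W_apart_seq_less [OF _ inc_seqs_singleton, of le A x] by simp

text \<open>It suffices to test one-element sequences: further moves only lower the width of the
  residual.\<close>

lemma W_le:
  assumes "narrow le A" "\<And>x. x \<in> A \<Longrightarrow> W le (apart le A {x}) < c"
  shows "W le A \<le> c"
proof -
  have "osucc (W le (apart le A (set s))) \<le> c" if s: "s \<in> inc_seqs A le" for s
  proof -
    obtain x t where xt: "s = x # t" using s by (cases s) (auto simp: inc_seqs_def)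
    have x: "x \<in> A" using s xt by (auto simp: inc_seqs_def)
    have "W le (apart le A (set s)) \<le> W le (apart le A {x})"
    proof (cases "t = []")
      case False
      then have "t \<in> inc_seqs (apart le A {x}) le"
        using s xt inc_seqs_append [of "[x]" A le t] x by (simp add: inc_seqs_singleton)
      then have "W le (apart le (apart le A {x}) (set t)) < W le (apart le A {x})"
        by (intro W_apart_seq_less narrow_apart assms(1))
      then show ?thesis by (simp add: xt apart_apart)
    qed (simp add: xt)
    then show ?thesis using assms(2) [OF x] by (simp add: osucc_le_iff)
  qed
  then show ?thesis
    using assms(1) unfolding narrow_def
    by (subst width_eq_osup) (auto intro!: osup_least)
qed

lemma less_WE:
  assumes "narrow le A" "z < W le A"
  obtains x where "x \<in> A" "z \<le> W le (apart le A {x})"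
proof -
  have "\<exists>x\<in>A. z \<le> W le (apart le A {x})"
  proof (rule ccontr)
    assume "\<not> (\<exists>x\<in>A. z \<le> W le (apart le A {x}))"
    then have "W le A \<le> z" by (intro W_le [OF assms(1)]) (simp add: not_le)
    then show False using assms(2) by simp
  qed
  then show ?thesis using that by blast
qed

text \<open>A map reflecting the order sends incomparable elements to incomparable ones, hence
  residuals into residuals.\<close>

lemma W_embed:
  assumes "narrow le A" "narrow le' A'" "\<And>x. x \<in> A \<Longrightarrow> f x \<in> A'"
    and "\<And>x y. x \<in> A \<Longrightarrow> y \<in> A \<Longrightarrow> le' (f x) (f y) \<Longrightarrow> le x y"
  shows "W le A \<le> W le' A'"
  using assms
proof (induction "W le A" arbitrary: A A' rule: less_induct)
  case less
  show ?case
  proof (rule W_le [OF less.prems(1)])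
    fix x assume x: "x \<in> A"
    have "W le (apart le A {x}) \<le> W le' (apart le' A' {f x})"
      using less.prems x
      by (intro less.hyps W_apart_less narrow_apart) (auto simp: apart_def)
    also have "\<dots> < W le' A'" using less.prems x by (intro W_apart_less) auto
    finally show "W le (apart le A {x}) < W le' A'" .
  qed
qed

lemma W_mono: "narrow le A' \<Longrightarrow> A \<subseteq> A' \<Longrightarrow> W le A \<le> W le A'"
  by (rule W_embed [where f = id]) (auto intro: narrow_subset)

lemma W_empty [simp]: "W le {} = ozero"
proof -
  have "narrow le {}" by (simp add: narrow_def small_finite no_infinite_antichain_def)
  from W_le [OF this, of ozero] show ?thesis by (simp add: order.antisym)
qed

lemma W_pos: "narrow le A \<Longrightarrow> x \<in> A \<Longrightarrow> ozero < W le A"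
  by (rule order.strict_trans1 [OF ozero_le W_apart_less])

text \<open>Once a sequence has visited a cell, it can no longer visit the cells in conflict with it;
  its remaining rank is at most the natural sum of the ranks in the cells still available.\<close>

lemma W_le_cells:
  assumes "narrow le A" "finite D" "\<And>x. x \<in> A \<Longrightarrow> cell x \<in> D"
    and "\<And>x y. x \<in> A \<Longrightarrow> y \<in> A \<Longrightarrow> conflict (cell x) (cell y) \<Longrightarrow> cell x \<noteq> cell y \<Longrightarrow> le x y \<or> le y x"
  shows "\<exists>S\<subseteq>D. (\<forall>d\<in>S. \<forall>e\<in>S. d \<noteq> e \<longrightarrow> \<not> conflict d e) \<and>
    W le A \<le> nsums.F (\<lambda>d. W le {x \<in> A. cell x = d}) S"
  using assms(1,3,4)
proof (induction "W le A" arbitrary: A rule: less_induct)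
  case less
  define Fam where "Fam = {S. S \<subseteq> D \<and> (\<forall>d\<in>S. \<forall>e\<in>S. d \<noteq> e \<longrightarrow> \<not> conflict d e)}"
  define f where "f B S = nsums.F (\<lambda>d. W le {x \<in> B. cell x = d}) S" for B S
  have fin: "finite Fam" using assms(2) by (auto simp: Fam_def intro: finite_subset [of _ "Pow D"])
  have ne: "{} \<in> Fam" by (simp add: Fam_def)
  \<comment> \<open>The best family depends on the first move \<open>x\<close>, so the target is the
    maximum over all conflict-free families.\<close>
  have "W le A \<le> Max (f A ` Fam)"
  proof (rule W_le [OF less.prems(1)])
    fix x assume x: "x \<in> A"
    define d where "d = cell x"
    let ?A = "apart le A {x}"
    have "\<exists>S\<subseteq>D. (\<forall>d\<in>S. \<forall>e\<in>S. d \<noteq> e \<longrightarrow> \<not> conflict d e) \<and> W le ?A \<le> f ?A S"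
      unfolding f_def using less.prems x
      by (intro less.hyps W_apart_less narrow_apart) (auto simp: apart_def)
    then obtain S' where S': "S' \<in> Fam" "W le ?A \<le> f ?A S'" by (auto simp: Fam_def)
    \<comment> \<open>The cell \<open>d\<close> joins and the cells in conflict with it leave; these
      contribute nothing, as all their elements are comparable to \<open>x\<close>.\<close>
    define S where "S = insert d {e \<in> S'. \<not> conflict d e \<and> \<not> conflict e d}"
    have S: "S \<in> Fam" using S'(1) less.prems(2) [OF x] by (auto simp: Fam_def S_def d_def)
    have finS: "finite S" "finite S'" using S S'(1) assms(2) by (auto simp: Fam_def intro: finite_subset)
    have "W le {y \<in> ?A. cell y = e} = ozero" if "e \<in> S' - S" for e
    proof -
      have e: "e \<noteq> d" "conflict d e \<or> conflict e d" using that by (auto simp: S_def)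
      have "{y \<in> ?A. cell y = e} = {}"
        using e less.prems(3) x by (fastforce simp: apart_def d_def)
      then show ?thesis by (simp only: W_empty)
    qed
    then have "f ?A S' = f ?A (S' \<inter> S)"
      unfolding f_def using finS by (intro nsums.mono_neutral_right) auto
    also have "\<dots> \<le> f ?A S" unfolding f_def using finS by (intro nsums_subset) auto
    \<comment> \<open>The move \<open>x\<close> strictly lowers the width of its own cell
      \<open>d\<close>.\<close>
    also have "\<dots> < f A S"
      unfolding f_def
    proof (rule nsums_strict_mono [OF finS(1), of d])
      have "{y \<in> ?A. cell y = d} = apart le {y \<in> A. cell y = d} {x}" by (auto simp: apart_def)
      then show "W le {y \<in> ?A. cell y = d} < W le {y \<in> A. cell y = d}"
        using x less.prems(1) by (auto simp: d_def intro!: W_apart_less intro: narrow_subset)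
      show "W le {y \<in> ?A. cell y = e} \<le> W le {y \<in> A. cell y = e}" for e
        using less.prems(1) by (intro W_mono) (auto simp: apart_def intro: narrow_subset)
    qed (simp add: S_def)
    also have "\<dots> \<le> Max (f A ` Fam)" using fin S by simp
    finally show "W le ?A < Max (f A ` Fam)" using S'(2) by simp
  qed
  moreover have "Max (f A ` Fam) \<in> f A ` Fam" using fin ne by (intro Max_in) auto
  ultimately obtain S where "S \<in> Fam" "W le A \<le> f A S" by auto
  then show ?case unfolding Fam_def f_def by blast
qed

text \<open>Moves in \<open>C\<close> of rank \<open>c\<close> come first, and by the last premise
  any finite number of them leaves width \<open>nsums.F v S\<close> in \<open>P\<close>. The natural
  sum does not exceed the resulting ordinary sum, because each \<open>v d\<close> absorbs
  \<open>c\<close>.\<close>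

lemma W_ge_nsum_first_part:
  assumes "finite S" "\<And>d. d \<in> S \<Longrightarrow> indecomposable (v d) \<and> c < v d"
    and "narrow le P" "C \<subseteq> P" "c \<le> W le C"
    and "\<And>F. finite F \<Longrightarrow> F \<subseteq> C \<Longrightarrow> nsums.F v S \<le> W le (apart le P F)"
  shows "nsum (nsums.F v S) c \<le> W le P"
  using assms(2-)
proof (induction c arbitrary: C P rule: less_induct)
  case (less c)
  show ?case
  proof (rule ccontr)
    assume "\<not> nsum (nsums.F v S) c \<le> W le P"
    then have "W le P < nsum (nsums.F v S) c" by simp
    then show False
    proof (cases rule: less_nsumE)
      case (left x)
      have "nsum x c < nsums.F v S" using assms(1) less.prems(1) left(1) by (rule nsums_absorb)
      also have "\<dots> \<le> W le P" using less.prems(5) [of "{}"] by simp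
      finally show False using left by simp
    next
      case (right c')
      have "narrow le C" using narrow_subset [OF less.prems(2,3)] .
      moreover have "c' < W le C" using right less.prems by simp
      ultimately obtain x where x: "x \<in> C" "c' \<le> W le (apart le C {x})" by (rule less_WE)
      have "nsum (nsums.F v S) c' \<le> W le (apart le P {x})"
      proof (rule less.IH [OF right(1) _ _ _ x(2)])
        show "\<And>d. d \<in> S \<Longrightarrow> indecomposable (v d) \<and> c' < v d"
          using less.prems(1) right(1) by (meson order.strict_trans)
        show "narrow le (apart le P {x})" using less.prems by (simp add: narrow_apart)
        show "apart le C {x} \<subseteq> apart le P {x}" using less.prems by (auto simp: apart_def)
        show "nsums.F v S \<le> W le (apart le (apart le P {x}) F)"
          if "finite F" "F \<subseteq> apart le C {x}" for F
          unfolding apart_apart using that x by (intro less.prems(5)) (auto simp: apart_def)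
      qed
      also have "\<dots> < W le P" using less.prems x by (intro W_apart_less) auto
      finally show False using right by simp
    qed
  qed
qed

text \<open>Here \<open>u\<close> may equal some \<open>v d\<close> and is then not absorbed. If the
  claim failed, the loss could be charged to \<open>u\<close>; one move in \<open>C\<close> leaves a
  rank at least \<open>c\<close>, and \<open>W_ge_nsum_first_part\<close> applies to
  \<open>c < u\<close>.\<close>

lemma W_ge_nsum_indecomposable:
  assumes "finite S" "\<And>d. d \<in> S \<Longrightarrow> indecomposable (v d) \<and> u \<le> v d" "indecomposable u"
    and "narrow le P" "C \<subseteq> P" "u \<le> W le C"
    and "\<And>F. finite F \<Longrightarrow> F \<subseteq> C \<Longrightarrow> nsums.F v S \<le> W le (apart le P F)"
  shows "nsum (nsums.F v S) u \<le> W le P"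
proof (rule ccontr)
  assume "\<not> nsum (nsums.F v S) u \<le> W le P"
  then have "W le P < nsum (nsums.F v S) u" by simp
  with assms(1-3) obtain c where c: "c < u" "W le P \<le> nsum (nsums.F v S) c"
    by (rule less_nsums_indecomposableE)
  have C: "narrow le C" using narrow_subset [OF assms(4,5)] .
  have "c < W le C" using c assms by simp
  from less_WE [OF C this] obtain x where x: "x \<in> C" "c \<le> W le (apart le C {x})" .
  have "nsum (nsums.F v S) c \<le> W le (apart le P {x})"
  proof (rule W_ge_nsum_first_part [OF assms(1) _ _ _ x(2)])
    show "\<And>d. d \<in> S \<Longrightarrow> indecomposable (v d) \<and> c < v d"
      using assms(2) c(1) by (meson order.strict_trans2)
    show "narrow le (apart le P {x})" using assms by (simp add: narrow_apart)
    show "apart le C {x} \<subseteq> apart le P {x}" using assms by (auto simp: apart_def)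
    show "nsums.F v S \<le> W le (apart le (apart le P {x}) F)"
      if "finite F" "F \<subseteq> apart le C {x}" for F
      unfolding apart_apart using that x by (intro assms(7)) (auto simp: apart_def)
  qed
  also have "\<dots> < W le P" using assms x by (intro W_apart_less) auto
  finally show False using c by simp
qed

text \<open>The relation \<open>before\<close> is the order in which the cells are played: playing the cells of small width
  first turns the ordinary sum of the widths into the natural sum.\<close>

lemma W_ge_nsums_cells:
  assumes "finite S" "narrow le U" "\<And>d. d \<in> S \<Longrightarrow> indecomposable (v d) \<and> B d \<subseteq> U"
    and first: "\<And>T. T \<subseteq> S \<Longrightarrow> T \<noteq> {} \<Longrightarrow> \<exists>d\<in>T. \<forall>e\<in>T - {d}. before d e \<and> v d \<le> v e"
    and alive: "\<And>e F. e \<in> S \<Longrightarrow> finite F \<Longrightarrow> F \<subseteq> (\<Union>d\<in>{d \<in> S - {e}. before d e}. B d) \<Longrightarrow>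
      v e \<le> W le (apart le (B e) F)"
  shows "nsums.F v S \<le> W le U"
proof -
  \<comment> \<open>\<open>T\<close> consists of the cells still to be played and \<open>F\<close>
    of the moves made so far, all in cells that come before those of \<open>T\<close>.\<close>
  have "nsums.F v T \<le> W le (apart le (\<Union>d\<in>T. B d) F)"
    if "T \<subseteq> S" "finite F" "F \<subseteq> (\<Union>d\<in>S - T. B d)" "\<forall>d\<in>S - T. \<forall>e\<in>T. before d e" for T F
    using that
  proof (induction "card T" arbitrary: T F)
    case 0
    then have "T = {}" using assms(1) by (metis card_0_eq finite_subset)
    then show ?case by simp
  next
    case (Suc k)
    have finT: "finite T" using Suc.prems assms(1) finite_subset by blast
    have "T \<noteq> {}" using Suc.hyps(2) by auto
    then obtain d where d: "d \<in> T" "\<forall>e\<in>T - {d}. before d e \<and> v d \<le> v e"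
      using first [OF Suc.prems(1)] by blast
    let ?P = "apart le (\<Union>d\<in>T. B d) F"
    have "nsum (nsums.F v (T - {d})) (v d) \<le> W le ?P"
    proof (rule W_ge_nsum_indecomposable)
      show "finite (T - {d})" using finT by simp
      show "indecomposable (v d)" using assms(3) [of d] d Suc.prems(1) by blast
      show "indecomposable (v e) \<and> v d \<le> v e" if "e \<in> T - {d}" for e
        using that assms(3) [of e] d Suc.prems(1) by blast
      show "narrow le ?P"
        using assms(3) Suc.prems by (intro narrow_apart narrow_subset [OF assms(2)]) blast
      show "apart le (B d) F \<subseteq> ?P" using d by (auto simp: apart_def)
      show "v d \<le> W le (apart le (B d) F)"
        using Suc.prems d by (intro alive) (auto, blast)
      fix G assume G: "finite G" "G \<subseteq> apart le (B d) F"
      \<comment> \<open>The moves \<open>G\<close> made in the cell \<open>d\<close> join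
        \<open>F\<close>, and \<open>d\<close> leaves \<open>T\<close>.\<close>
      have "nsums.F v (T - {d}) \<le> W le (apart le (\<Union>d\<in>T - {d}. B d) (F \<union> G))"
      proof (rule Suc.hyps(1))
        show "k = card (T - {d})" using Suc.hyps(2) d finT by simp
        show "F \<union> G \<subseteq> (\<Union>d\<in>S - (T - {d}). B d)"
          using Suc.prems G d by (auto simp: apart_def)
      qed (use Suc.prems G d in auto)
      also have "\<dots> \<le> W le (apart le ?P G)"
        unfolding apart_apart using assms(3) Suc.prems
        by (intro W_mono narrow_apart narrow_subset [OF assms(2)]) (auto simp: apart_def)
      finally show "nsums.F v (T - {d}) \<le> W le (apart le ?P G)" .
    qed
    then show ?case using nsums.remove [OF finT d(1), of v] by (simp add: nsum_commute)
  qed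
  from this [of S "{}"] have "nsums.F v S \<le> W le (\<Union>d\<in>S. B d)" by simp
  also have "\<dots> \<le> W le U" using assms by (intro W_mono) auto
  finally show ?thesis .
qed

section \<open>Boxes with indecomposable sides\<close>

definition Box :: "nat \<Rightarrow> (nat \<Rightarrow> 'o) \<Rightarrow> 'o list set" where
  "Box n v = {x. length x = n \<and> (\<forall>i<n. x ! i < v i)}"

lemma map_in_Box: "(\<And>i. i < n \<Longrightarrow> f i < v i) \<Longrightarrow> map f [0..<n] \<in> Box n v"
  by (simp add: Box_def)

lemma narrow_Box:
  assumes "\<And>i. i < n \<Longrightarrow> v i \<le> a0"
  shows "narrow (vle n) (Box n v)"
proof -
  have "Box n v \<subseteq> lists {..<a0}"
    using assms by (fastforce simp: Box_def in_set_conv_nth)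
  moreover have "small (lists {..<a0})"
    by (rule small_lists) (simp add: small_def card_of_refl ordIso_imp_ordLeq)
  ultimately have "small (Box n v)" by (rule small_subset [rotated])
  then show ?thesis
    by (simp add: narrow_def no_infinite_antichain_vle) (simp add: vle_def)
qed

lemma exceeds_finite:
  assumes "indecomposable v" "one < v" "finite G" "\<And>g. g \<in> G \<Longrightarrow> g < v"
  shows "\<exists>t<v. \<forall>g\<in>G. g < t"
  using assms(3,4)
proof (induction G rule: finite_induct)
  case empty
  then show ?case using indecomposable_pos [OF assms(1)] by auto
next
  case (insert g G)
  then obtain t where t: "t < v" "\<forall>g\<in>G. g < t" by blast
  have "nsum (max g t) one < v" using t insert.prems assms by (simp add: indecomposable_nsum)
  moreover have "\<forall>h\<in>insert g G. h < nsum (max g t) one"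
    using t by (auto simp: nsum_one less_osucc_iff le_max_iff_disj order.strict_implies_order)
  ultimately show ?case by blast
qed

text \<open>The layers \<open>B m\<close> of thickness \<open>t\<close> in direction
  \<open>p\<close> are played from the top down. The slice is lifted into layer \<open>m\<close> and
  shifted by \<open>s\<close> in direction \<open>q\<close>: earlier moves then lie above it in
  \<open>p\<close> and below it in \<open>q\<close>.\<close>

lemma W_Box_ge_nmul:
  assumes v: "\<And>i. i < n \<Longrightarrow> indecomposable (v i) \<and> v i \<le> a0"
    and pq: "p < n" "q < n" "p \<noteq> q" "one < v q" and t: "t < v p"
    and u: "indecomposable u" "u \<le> W (vle n) {y \<in> Box n v. y ! p < t}"
  shows "nmul M u \<le> W (vle n) (Box n v)"
proof -
  define B where "B m = {y \<in> Box n v. nmul m t \<le> y ! p \<and> y ! p < nmul (Suc m) t}" for m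
  have nar: "narrow (vle n) (Box n v)" using v by (simp add: narrow_Box)
  have "nsums.F (\<lambda>_. u) {..<M} \<le> W (vle n) (Box n v)"
  proof (rule W_ge_nsums_cells [where B = B and before = "\<lambda>m m'. m' < m"])
    show "finite {..<M}" by simp
    show "indecomposable u \<and> B m \<subseteq> Box n v" for m using u by (auto simp: B_def)
    show "\<exists>d\<in>T. \<forall>e\<in>T - {d}. e < d \<and> u \<le> u" if "T \<subseteq> {..<M}" "T \<noteq> {}" for T
    proof -
      have "finite T" using that finite_subset by blast
      then show ?thesis using that Max_in [of T] Max_ge [of T]
        by (intro bexI [of _ "Max T"]) (auto simp: order.strict_iff_order)
    qed
    fix m F assume m: "m \<in> {..<M}" and F: "finite F" "F \<subseteq> (\<Union>d\<in>{d \<in> {..<M} - {m}. m < d}. B d)"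
    have FB: "g \<in> Box n v \<and> nmul (Suc m) t \<le> g ! p" if g: "g \<in> F" for g
    proof -
      obtain d where d: "m < d" "g \<in> B d" using F(2) g by blast
      then have "nmul (Suc m) t \<le> nmul d t" by (intro nmul_mono_left) simp
      then show ?thesis using d(2) by (auto simp: B_def)
    qed
    have "\<exists>s<v q. \<forall>g\<in>(\<lambda>g. g ! q) ` F. g < s"
      using v pq F(1) FB by (intro exceeds_finite) (auto simp: Box_def)
    then obtain s where s: "s < v q" "\<And>g. g \<in> F \<Longrightarrow> g ! q < s" by auto
    define h where "h y = map (\<lambda>i. if i = p then nsum (nmul m t) (y ! i)
      else if i = q then nsum (y ! i) s else y ! i) [0..<n]" for y
    have hp: "h y ! p = nsum (nmul m t) (y ! p)" and hq: "h y ! q = nsum (y ! q) s" for y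
      using pq by (auto simp: h_def)
    have "W (vle n) {y \<in> Box n v. y ! p < t} \<le> W (vle n) (apart (vle n) (B m) F)"
    proof (rule W_embed [where f = h])
      show "narrow (vle n) {y \<in> Box n v. y ! p < t}" by (rule narrow_subset [OF nar]) auto
      show "narrow (vle n) (apart (vle n) (B m) F)"
        by (rule narrow_subset [OF nar]) (auto simp: apart_def B_def)
      show "vle n x y" if "vle n (h x) (h y)" for x y
        unfolding vle_def
      proof (intro allI impI)
        fix i assume i: "i < n"
        then have "h x ! i \<le> h y ! i" using that by (simp add: vle_def)
        then show "x ! i \<le> y ! i"
          using i by (simp add: h_def nsum_le_cancel_left nsum_le_cancel_right split: if_splits)
      qed
      fix y assume y: "y \<in> {y \<in> Box n v. y ! p < t}"
      have less: "h y ! p < nmul (Suc m) t" using y by (simp add: hp nsum_less_right)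
      have "h y \<in> Box n v"
        unfolding h_def
      proof (rule map_in_Box)
        fix i assume "i < n"
        then show "(if i = p then nsum (nmul m t) (y ! i)
          else if i = q then nsum (y ! i) s else y ! i) < v i"
          using v y s t by (auto simp: Box_def intro!: indecomposable_nsum indecomposable_nmul)
      qed
      then have "h y \<in> B m" using less by (simp add: B_def hp nsum_ge_left)
      moreover have "\<not> vle n g (h y)" if "g \<in> F" for g
        using FB [OF that] less pq by (auto simp: vle_def not_le intro!: exI [of _ p])
      moreover have "\<not> vle n (h y) g" if "g \<in> F" for g
      proof -
        have "g ! q < h y ! q" using s(2) [OF that] nsum_ge_right [of s "y ! q"] by (simp add: hq)
        then show ?thesis using pq by (auto simp: vle_def not_le)
      qed
      ultimately show "h y \<in> apart (vle n) (B m) F" by (auto simp: apart_def)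
    qed
    then show "u \<le> W (vle n) (apart (vle n) (B m) F)" using u(2) by simp
  qed (rule nar)
  then show ?thesis by (simp add: nsums_const)
qed

text \<open>An element incomparable to \<open>x\<close> lies below \<open>x\<close> in some
  coordinate; the first one serves as its cell. Using a bound \<open>t\<close> in place of
  \<open>x\<close> lets several first moves share the same slices.\<close>

lemma W_apart_Box_le:
  assumes v: "\<And>i. i < n \<Longrightarrow> v i \<le> a0" and t: "\<And>i. i < n \<Longrightarrow> x ! i \<le> t i"
  shows "W (vle n) (apart (vle n) (Box n v) {x}) \<le> nsums.F (\<lambda>i. W (vle n) {y \<in> Box n v. y ! i < t i}) {..<n}"
proof -
  let ?A = "apart (vle n) (Box n v) {x}"
  define cell where "cell y = (LEAST i. i < n \<and> y ! i < x ! i)" for y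
  have nar: "narrow (vle n) (Box n v)" using v by (simp add: narrow_Box)
  have cell: "cell y < n \<and> y ! cell y < x ! cell y" if "y \<in> ?A" for y
  proof -
    have "\<exists>i. i < n \<and> y ! i < x ! i" using that by (auto simp: apart_def vle_def not_le)
    then show ?thesis unfolding cell_def by (rule LeastI_ex)
  qed
  obtain S where S: "S \<subseteq> {..<n}" "W (vle n) ?A \<le> nsums.F (\<lambda>d. W (vle n) {y \<in> ?A. cell y = d}) S"
    using W_le_cells [of "vle n" ?A "{..<n}" cell "\<lambda>_ _. False"] cell narrow_apart [OF nar] by auto
  have "nsums.F (\<lambda>d. W (vle n) {y \<in> ?A. cell y = d}) S \<le> nsums.F (\<lambda>d. W (vle n) {y \<in> Box n v. y ! d < t d}) S"
  proof (rule nsums_mono, rule W_mono)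
    fix d assume d: "d \<in> S"
    show "narrow (vle n) {y \<in> Box n v. y ! d < t d}" by (rule narrow_subset [OF nar]) auto
    show "{y \<in> ?A. cell y = d} \<subseteq> {y \<in> Box n v. y ! d < t d}"
      using cell t d S(1) by (auto simp: apart_def intro: order.strict_trans2)
  qed
  also have "\<dots> \<le> nsums.F (\<lambda>d. W (vle n) {y \<in> Box n v. y ! d < t d}) {..<n}"
    using S(1) by (intro nsums_subset) auto
  finally show ?thesis using S(2) by simp
qed

lemma zero_in_Box: "(\<And>i. i < n \<Longrightarrow> indecomposable (v i)) \<Longrightarrow> replicate n ozero \<in> Box n v"
  by (simp add: Box_def indecomposable_pos)

text \<open>All coordinates but at most one are constantly \<open>ozero\<close>, so the box is a
  nonempty chain.\<close>

lemma W_Box_chain: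
  assumes v: "\<And>i. i < n \<Longrightarrow> indecomposable (v i) \<and> v i \<le> a0"
    and chain: "\<And>i j. i < n \<Longrightarrow> j < n \<Longrightarrow> i \<noteq> j \<Longrightarrow> v i = one \<or> v j = one"
  shows "W (vle n) (Box n v) = one"
proof (rule order.antisym)
  have nar: "narrow (vle n) (Box n v)" using v by (simp add: narrow_Box)
  show "one \<le> W (vle n) (Box n v)"
    using W_pos [OF nar zero_in_Box] v by (simp add: one_def osucc_le_iff)
  show "W (vle n) (Box n v) \<le> one"
  proof (rule W_le [OF nar])
    fix x assume x: "x \<in> Box n v"
    have "vle n x y \<or> vle n y x" if y: "y \<in> Box n v" for y
    proof (cases "\<exists>i<n. v i \<noteq> one")
      case True
      then obtain i where i: "i < n" "v i \<noteq> one" by blast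
      then have "x ! j = ozero \<and> y ! j = ozero" if "j < n" "j \<noteq> i" for j
        using chain [of i j] that x y by (auto simp: Box_def less_one_iff)
      then show ?thesis unfolding vle_def by (metis linear order_refl)
    next
      case False
      then show ?thesis using x y by (auto simp: vle_def Box_def less_one_iff)
    qed
    then have "apart (vle n) (Box n v) {x} = {}" by (auto simp: apart_def)
    then show "W (vle n) (apart (vle n) (Box n v) {x}) < one" by (simp add: less_one_iff)
  qed
qed

text \<open>A sequence starting with \<open>x\<close> stays in the union of the slices \<open>y ! i < x ! i\<close>. Since \<open>v i\<close> is
  indecomposable, arbitrarily many copies of each slice can be stacked inside the box, so that the
  width of the box exceeds all finite multiples of the width of a slice.\<close>

lemma indecomposable_W_Box:
  assumes v: "\<And>i. i < n \<Longrightarrow> indecomposable (v i) \<and> v i \<le> a0"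
  shows "indecomposable (W (vle n) (Box n v))"
proof (cases "\<exists>p<n. \<exists>q<n. p \<noteq> q \<and> v p \<noteq> one \<and> v q \<noteq> one")
  case False
  then have "W (vle n) (Box n v) = one" using v by (intro W_Box_chain) auto
  then show ?thesis by (simp add: indecomposable_one)
next
  case True
  then obtain p q where pq: "p < n" "q < n" "p \<noteq> q" "v p \<noteq> one" "v q \<noteq> one" by blast
  have nar: "narrow (vle n) (Box n v)" using v by (simp add: narrow_Box)
  have big: "one < v i" if "i < n" "v i \<noteq> one" for i
    using that v indecomposable_one_le by (metis order.not_eq_order_implies_strict)
  show ?thesis
    unfolding indecomposable_def
  proof (intro conjI allI impI)
    show pos: "ozero < W (vle n) (Box n v)" using W_pos [OF nar zero_in_Box] v by simp
    fix a b assume a: "a < W (vle n) (Box n v)" and b: "b < W (vle n) (Box n v)"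
    obtain x where x: "x \<in> Box n v" "a \<le> W (vle n) (apart (vle n) (Box n v) {x})"
      using nar a by (rule less_WE)
    obtain y where y: "y \<in> Box n v" "b \<le> W (vle n) (apart (vle n) (Box n v) {y})"
      using nar b by (rule less_WE)
    \<comment> \<open>The maximum lets one system of slices serve both first moves \<open>x\<close>
      and \<open>y\<close>.\<close>
    define t where "t i = max (x ! i) (y ! i)" for i
    define d where "d i = W (vle n) {z \<in> Box n v. z ! i < t i}" for i
    define D where "D = Max (d ` {..<n})"
    have "D \<in> d ` {..<n}" unfolding D_def using pq by (intro Max_in) auto
    then obtain k where k: "k < n" "D = d k" by auto
    have sum: "nsums.F d {..<n} \<le> nmul n D"
      using nsums_mono [of "{..<n}" d "\<lambda>_. D"] by (simp add: nsums_const D_def)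
    have "a \<le> nmul n D"
      using x(2) W_apart_Box_le [of n v x t] v sum unfolding d_def t_def by (auto intro: order.trans)
    moreover have "b \<le> nmul n D"
      using y(2) W_apart_Box_le [of n v y t] v sum unfolding d_def t_def by (auto intro: order.trans)
    ultimately have ab: "nsum a b \<le> nmul (n + n) D" by (simp add: nmul_add nsum_mono)
    show "nsum a b < W (vle n) (Box n v)"
    proof (cases "D = ozero")
      case True
      then have "nmul (n + n) D = ozero" using nsums_const [of "{..<n + n}" ozero] by simp
      then show ?thesis using ab pos by simp
    next
      case False
      \<comment> \<open>Stacking by \<open>W_Box_ge_nmul\<close> counts indecomposable ordinals, so
        \<open>D\<close> is replaced by its leading term up to a finite factor.\<close>
      then obtain u l where u: "indecomposable u" "u \<le> D" "D \<le> nmul l u" by (rule le_nmul_indecomposable)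
      \<comment> \<open>One of \<open>p\<close> and \<open>q\<close> differs from the stacking
        direction \<open>k\<close> and leaves room for the sideways shift.\<close>
      obtain r where r: "r < n" "k \<noteq> r" "one < v r"
        using pq big [of p] big [of q] by metis
      have "t k < v k" using x(1) y(1) k by (simp add: t_def Box_def)
      then have M: "nmul M u \<le> W (vle n) (Box n v)" for M
        using W_Box_ge_nmul [of n v k r "t k" u M] v k r u unfolding d_def by simp
      have "nsum a b \<le> nmul (n + n) (nmul l u)" using ab nmul_mono [OF u(3)] by (rule order.trans)
      also have "\<dots> = nmul ((n + n) * l) u" by (simp only: nmul_mult)
      \<comment> \<open>One additional copy makes the estimate strict.\<close>
      also have "\<dots> < nmul (Suc ((n + n) * l)) u"
        using nsum_less_right [OF indecomposable_pos [OF u(1)], of "nmul ((n + n) * l) u"] by (simp add: nsum_ozero)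
      also have "\<dots> \<le> W (vle n) (Box n v)" by (rule M)
      finally show ?thesis .
    qed
  qed
qed

end

section \<open>Products of ordinals\<close>

text \<open>\<open>v i\<close> lists the normal form terms of the \<open>i\<close>-th factor and
  \<open>r i\<close> is their number. A factor is infinite exactly when its leading term exceeds
  \<open>one\<close>, which \<open>infinite_first\<close> records.\<close>

locale ordinal_product = regular_ordinals a0 for a0 :: "'o::wellorder" +
  fixes n :: nat and v :: "nat \<Rightarrow> nat \<Rightarrow> 'o" and r :: "nat \<Rightarrow> nat" and ks :: "nat list"
  assumes n_pos: "0 < n"
    and nf: "\<And>i. i < n \<Longrightarrow> normal_form (v i) (r i)"
    and infinite_first: "\<And>i. i < n \<Longrightarrow> 0 < r i \<and> one < v i 0"
    and below_a0: "\<And>i. i < n \<Longrightarrow> nsums.F (v i) {..<r i} \<le> a0"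
begin

definition X :: "'o list set" where "X = Box n (\<lambda>i. nsums.F (v i) {..<r i})"

definition K :: "nat list set" where "K = {y. list_all2 (<) y ks}"

definition D :: "nat list set" where "D = {d. length d = n \<and> (\<forall>i<n. d ! i < r i)}"

definition cellset :: "nat list \<Rightarrow> 'o list set" where
  "cellset d = {x. length x = n \<and> (\<forall>i<n. x ! i \<in> block (v i) (d ! i))}"

definition cell :: "'o list \<Rightarrow> nat list" where
  "cell x = map (\<lambda>i. SOME j. j < r i \<and> x ! i \<in> block (v i) j) [0..<n]"

text \<open>The width of a cell, taken on the isomorphic box of offsets.\<close>

definition nu :: "nat list \<Rightarrow> 'o" where
  "nu d = W (vle n) (Box n (\<lambda>i. v i (d ! i)))"

text \<open>An index criterion for every element of cell \<open>d\<close> to lie below every element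
  of cell \<open>e\<close>; a shared infinite block would destroy this.\<close>

definition dominated :: "nat list \<Rightarrow> nat list \<Rightarrow> bool" where
  "dominated d e \<longleftrightarrow> (\<forall>i<n. d ! i \<le> e ! i \<and> (d ! i = e ! i \<longrightarrow> v i (d ! i) = one))"

text \<open>Such a cell is a single point.\<close>

definition singular :: "nat list \<Rightarrow> bool" where
  "singular d \<longleftrightarrow> (\<forall>i<n. v i (d ! i) = one)"

section \<open>Cells and their widths\<close>

lemma finite_D: "finite D"
proof (rule finite_subset)
  let ?M = "Max (r ` {..<n})"
  show "D \<subseteq> {xs. set xs \<subseteq> {..<?M} \<and> length xs = n}"
  proof
    fix d assume d: "d \<in> D"
    have "d ! i < ?M" if i: "i < n" for i
    proof -
      have "d ! i < r i" using d i by (simp add: D_def)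
      also have "r i \<le> ?M" using i by (intro Max_ge) auto
      finally show ?thesis .
    qed
    then show "d \<in> {xs. set xs \<subseteq> {..<?M} \<and> length xs = n}"
      using d by (auto simp: D_def in_set_conv_nth)
  qed
  show "finite {xs. set xs \<subseteq> {..<?M} \<and> length xs = n}" by (rule finite_lists_length_eq) simp
qed

lemma D_length: "d \<in> D \<Longrightarrow> length d = n"
  by (simp add: D_def)

lemma D_nth: "d \<in> D \<Longrightarrow> i < n \<Longrightarrow> d ! i < r i"
  by (simp add: D_def)

lemma D_indecomposable: "d \<in> D \<Longrightarrow> i < n \<Longrightarrow> indecomposable (v i (d ! i))"
  by (rule normal_form_indecomposable [OF nf D_nth])

lemma term_le_a0: "i < n \<Longrightarrow> j < r i \<Longrightarrow> v i j \<le> a0"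
proof -
  assume "i < n" "j < r i"
  have "v i j \<le> nsums.F (v i) {..<r i}"
    using nsums_subset [of "{..<r i}" "{j}" "v i"] \<open>j < r i\<close> by (simp add: nsum_ozero)
  then show ?thesis using below_a0 [OF \<open>i < n\<close>] by simp
qed

lemma narrow_X: "narrow (vle n) X"
  unfolding X_def by (rule narrow_Box) (rule below_a0)

lemma narrow_cell_Box: "d \<in> D \<Longrightarrow> narrow (vle n) (Box n (\<lambda>i. v i (d ! i)))"
  by (rule narrow_Box) (simp add: term_le_a0 D_nth)

lemma indecomposable_nu: "d \<in> D \<Longrightarrow> indecomposable (nu d)"
  unfolding nu_def by (rule indecomposable_W_Box) (simp add: D_indecomposable term_le_a0 D_nth)

lemma nu_mono:
  assumes "d \<in> D" "\<And>i. i < n \<Longrightarrow> v i (e ! i) \<le> v i (d ! i)"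
  shows "nu e \<le> nu d"
  unfolding nu_def
  by (rule W_mono [OF narrow_cell_Box [OF assms(1)]]) (use assms(2) in \<open>auto simp: Box_def intro: order.strict_trans2\<close>)

text \<open>Normal form terms do not increase. Hence upper cells are no wider, and playing small
  widths first is compatible with playing upper cells before lower ones.\<close>

lemma nu_antimono:
  assumes "d \<in> D" "e \<in> D" "list_all2 (\<le>) d e"
  shows "nu e \<le> nu d"
  using assms(2,3) D_length [OF assms(1)]
  by (intro nu_mono [OF assms(1)] normal_form_antimono [OF nf] D_nth) (auto simp: list_all2_conv_all_nth)

lemma cellset_subset_X: "d \<in> D \<Longrightarrow> cellset d \<subseteq> X"
  using block_less_top D_nth unfolding cellset_def X_def Box_def by blast

lemma cell_in_D:
  assumes "x \<in> X" shows "cell x \<in> D" "x \<in> cellset (cell x)"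
proof -
  have "\<exists>j. j < r i \<and> x ! i \<in> block (v i) j" if "i < n" for i
    using block_exists [of "x ! i" "v i" "r i"] assms that unfolding X_def Box_def by blast
  then have *: "cell x ! i < r i \<and> x ! i \<in> block (v i) (cell x ! i)" if "i < n" for i
    using that someI_ex [of "\<lambda>j. j < r i \<and> x ! i \<in> block (v i) j"] by (simp add: cell_def)
  then show "cell x \<in> D" by (simp add: D_def cell_def)
  show "x \<in> cellset (cell x)" using * assms by (simp add: cellset_def X_def Box_def)
qed

lemma dominated_le:
  assumes "dominated d e" "x \<in> cellset d" "y \<in> cellset e"
  shows "vle n x y"
  unfolding vle_def
proof (intro allI impI)
  fix i assume i: "i < n"
  have xy: "x ! i \<in> block (v i) (d ! i)" "y ! i \<in> block (v i) (e ! i)"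
    using assms i by (auto simp: cellset_def)
  show "x ! i \<le> y ! i"
  proof (cases "d ! i = e ! i")
    case True
    then show ?thesis using xy assms(1) i block_one [of "v i" "d ! i" "x ! i" "y ! i"]
      by (simp add: dominated_def)
  next
    case False
    then have "d ! i < e ! i" using assms(1) i by (simp add: dominated_def order.not_eq_order_implies_strict)
    then show ?thesis using block_less [OF xy] by simp
  qed
qed

text \<open>Passing to offsets within the blocks embeds the cell into its box.\<close>

lemma W_cellset_le:
  assumes "d \<in> D" shows "W (vle n) (cellset d) \<le> nu d"
proof -
  let ?R = "\<lambda>i. nsums.F (v i) {..<d ! i}"
  have "\<exists>c<v i (d ! i). b = nsum (?R i) c" if "i < n" "b \<in> block (v i) (d ! i)" for i b
    using block_offset [OF nf D_nth [OF assms]] that by blast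
  then have "\<forall>i b. \<exists>c. i < n \<and> b \<in> block (v i) (d ! i) \<longrightarrow> c < v i (d ! i) \<and> b = nsum (?R i) c" by blast
  then obtain off where off: "\<And>i b. i < n \<and> b \<in> block (v i) (d ! i) \<longrightarrow> off i b < v i (d ! i) \<and> b = nsum (?R i) (off i b)"
    by metis
  show ?thesis
    unfolding nu_def
  proof (rule W_embed [where f = "\<lambda>x. map (\<lambda>i. off i (x ! i)) [0..<n]"])
    show "narrow (vle n) (cellset d)" by (rule narrow_subset [OF narrow_X cellset_subset_X [OF assms]])
    show "narrow (vle n) (Box n (\<lambda>i. v i (d ! i)))" by (rule narrow_cell_Box [OF assms])
    show "map (\<lambda>i. off i (x ! i)) [0..<n] \<in> Box n (\<lambda>i. v i (d ! i))" if "x \<in> cellset d" for x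
      using that off by (intro map_in_Box) (simp add: cellset_def)
    show "vle n x y" if "x \<in> cellset d" "y \<in> cellset d"
      "vle n (map (\<lambda>i. off i (x ! i)) [0..<n]) (map (\<lambda>i. off i (y ! i)) [0..<n])" for x y
      unfolding vle_def
    proof (intro allI impI)
      fix i assume i: "i < n"
      have "off i (x ! i) \<le> off i (y ! i)" using that(3) i by (simp add: vle_def)
      then have "nsum (?R i) (off i (x ! i)) \<le> nsum (?R i) (off i (y ! i))" by (simp add: nsum_le_cancel_left)
      then show "x ! i \<le> y ! i" using off [of i "x ! i"] off [of i "y ! i"] that i by (simp add: cellset_def)
    qed
  qed
qed

section \<open>Bounding the width of \<open>X\<close> by a family of cells\<close>

lemma W_X_le_cells:
  obtains S where "S \<subseteq> D" "\<And>d e. d \<in> S \<Longrightarrow> e \<in> S \<Longrightarrow> d \<noteq> e \<Longrightarrow> \<not> dominated d e"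
    "W (vle n) X \<le> nsums.F nu S"
proof -
  have "\<exists>S\<subseteq>D. (\<forall>d\<in>S. \<forall>e\<in>S. d \<noteq> e \<longrightarrow> \<not> dominated d e) \<and>
    W (vle n) X \<le> nsums.F (\<lambda>d. W (vle n) {x \<in> X. cell x = d}) S"
    using dominated_le cell_in_D by (intro W_le_cells [OF narrow_X finite_D]) blast+
  then obtain S where S: "S \<subseteq> D" "\<forall>d\<in>S. \<forall>e\<in>S. d \<noteq> e \<longrightarrow> \<not> dominated d e"
    "W (vle n) X \<le> nsums.F (\<lambda>d. W (vle n) {x \<in> X. cell x = d}) S" by blast
  have "nsums.F (\<lambda>d. W (vle n) {x \<in> X. cell x = d}) S \<le> nsums.F nu S"
  proof (rule nsums_mono)
    fix d assume "d \<in> S"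
    then have d: "d \<in> D" using S(1) by blast
    have "W (vle n) {x \<in> X. cell x = d} \<le> W (vle n) (cellset d)"
      using cell_in_D(2) by (intro W_mono narrow_subset [OF narrow_X cellset_subset_X [OF d]]) auto
    then show "W (vle n) {x \<in> X. cell x = d} \<le> nu d" using W_cellset_le [OF d] by simp
  qed
  then show ?thesis using that [of S] S by simp
qed

lemma term_one_mono: "i < n \<Longrightarrow> v i j = one \<Longrightarrow> j \<le> k \<Longrightarrow> k < r i \<Longrightarrow> v i k = one"
  using normal_form_antimono [OF nf, of i j k] indecomposable_one_le [OF normal_form_indecomposable [OF nf, of i k]]
  by simp

text \<open>A singular cell is a single point, hence comparable to its own copies in \<open>X \<times> K\<close>. In the first
  coordinate it can be moved down to the last infinite block.\<close>

lemma W_X_le_nonsingular_cells: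
  obtains S where "S \<subseteq> D" "\<And>d e. d \<in> S \<Longrightarrow> e \<in> S \<Longrightarrow> d \<noteq> e \<Longrightarrow> \<not> dominated d e"
    "\<And>d. d \<in> S \<Longrightarrow> \<not> singular d" "W (vle n) X \<le> nsums.F nu S"
proof -
  obtain S where S: "S \<subseteq> D" "\<And>d e. d \<in> S \<Longrightarrow> e \<in> S \<Longrightarrow> d \<noteq> e \<Longrightarrow> \<not> dominated d e"
    "W (vle n) X \<le> nsums.F nu S" by (rule W_X_le_cells) simp
  \<comment> \<open>\<open>L\<close> will be the last block of the first factor with more than one
    point; \<open>J\<close> is nonempty because that factor is infinite.\<close>
  define J where "J = {j. j < r 0 \<and> v 0 j \<noteq> one}"
  define L where "L = Max J"
  have J: "finite J" "0 \<in> J" using infinite_first [OF n_pos] by (auto simp: J_def)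
  have "L \<in> J" unfolding L_def using J by (intro Max_in) auto
  then have L: "L < r 0" "v 0 L \<noteq> one" by (auto simp: J_def)
  have above_L: "v 0 j = one" if "L < j" "j < r 0" for j
  proof (rule ccontr)
    assume "v 0 j \<noteq> one"
    then have "j \<le> L" unfolding L_def using that J by (intro Max_ge) (auto simp: J_def)
    then show False using that by simp
  qed
  have sing_L: "L < d ! 0" if "singular d" for d
  proof (rule ccontr)
    assume "\<not> L < d ! 0"
    then have "v 0 L = one" using that n_pos L by (intro term_one_mono [of 0 "d ! 0" L]) (auto simp: singular_def)
    then show False using L by simp
  qed
  define m where "m d = (if singular d then d[0 := L] else d)" for d
  have nth0: "d[0 := L] ! 0 = L" if "d \<in> D" for d using that n_pos by (simp add: D_def)
  have nthS: "d[0 := L] ! i = d ! i" if "0 < i" for d i using that by simp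
  have mD: "m d \<in> D" if "d \<in> D" for d
    using that L by (auto simp: m_def D_def nth_list_update)
  have nonsing: "\<not> singular (m d)" if "d \<in> D" for d
    using that L nth0 [OF that] n_pos by (auto simp: m_def singular_def)
  have key: "\<not> dominated (m d) (m e)" if de: "d \<in> S" "e \<in> S" "d \<noteq> e" for d e
  proof
    assume dom: "dominated (m d) (m e)"
    have D: "d \<in> D" "e \<in> D" using de S(1) by auto
    show False
    proof (cases "singular d")
      case True
      then have d0: "m d ! 0 = L" using nth0 D by (simp add: m_def)
      \<comment> \<open>Block \<open>L\<close> is infinite, so domination forces
        \<open>m e ! 0\<close> above \<open>L\<close> and \<open>e\<close> was not moved. But then
        all indices of \<open>e\<close> lie in one-point blocks, making \<open>e\<close>
        singular.\<close>
      have "m e ! 0 \<noteq> L" using dom n_pos d0 L by (auto simp: dominated_def)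
      then have ns: "\<not> singular e" using nth0 D by (auto simp: m_def)
      then have "L < e ! 0" using dom n_pos d0 \<open>m e ! 0 \<noteq> L\<close>
        by (auto simp: dominated_def m_def order.not_eq_order_implies_strict)
      then have e0: "v 0 (e ! 0) = one" using above_L D n_pos by (simp add: D_nth)
      have "v i (e ! i) = one" if i: "i < n" for i
      proof (cases "i = 0")
        case False
        then have "d ! i \<le> e ! i" using dom i True ns by (auto simp: dominated_def m_def)
        moreover have "v i (d ! i) = one" using True i by (simp add: singular_def)
        ultimately show ?thesis using term_one_mono i D by (simp add: D_nth)
      qed (use e0 in simp)
      then show False using ns by (simp add: singular_def)
    next
      case nd: False
      \<comment> \<open>If \<open>e\<close> was moved down, its original index \<open>e ! 0\<close>
        lies above \<open>L\<close>, so domination persists for \<open>e\<close> itself.\<close>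
      have "dominated d e"
      proof (cases "singular e")
        case True
        have "d ! i \<le> e ! i \<and> (d ! i = e ! i \<longrightarrow> v i (d ! i) = one)" if i: "i < n" for i
        proof (cases "i = 0")
          case True
          have "d ! 0 \<le> m e ! 0" using dom n_pos nd by (simp add: dominated_def m_def)
          then have "d ! 0 < e ! 0" using sing_L [OF \<open>singular e\<close>] nth0 [OF D(2)] \<open>singular e\<close> by (simp add: m_def)
          then show ?thesis using True by simp
        next
          case False
          then have "m e ! i = e ! i" by (simp add: m_def)
          then show ?thesis using dom i nd by (auto simp: dominated_def m_def)
        qed
        then show ?thesis by (simp add: dominated_def)
      qed (use dom nd in \<open>simp add: m_def\<close>)
      then show False using S(2) de by blast
    qed
  qed
  \<comment> \<open>Distinct members of \<open>S\<close> with the same image differ only in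
    coordinate \<open>0\<close>, and one is singular. All other coordinates then lie in one-point
    blocks, so the two form a dominated pair.\<close>
  have inj: "inj_on m S"
  proof (rule inj_onI, rule ccontr)
    fix d e assume de: "d \<in> S" "e \<in> S" "m d = m e" "d \<noteq> e"
    then have D: "d \<in> D" "e \<in> D" using S(1) by auto
    have "dominated d e \<or> dominated e d"
    proof -
      have agree: "d ! i = e ! i" if "0 < i" for i
        using arg_cong [OF de(3), of "\<lambda>x. x ! i"] that by (simp add: m_def split: if_splits)
      have sing: "singular d \<or> singular e" using de(3,4) unfolding m_def by metis
      have one: "v i (d ! i) = one" if "0 < i" "i < n" for i
        using agree [OF that(1)] sing that by (auto simp: singular_def)
      have "d ! 0 \<noteq> e ! 0"
      proof
        assume "d ! 0 = e ! 0"
        then have "d ! i = e ! i" for i using agree by (cases "i = 0") auto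
        then show False using de(4) D by (simp add: nth_equalityI D_length)
      qed
      then consider "d ! 0 < e ! 0" | "e ! 0 < d ! 0" by linarith
      then show ?thesis
      proof cases
        case 1
        have "d ! i \<le> e ! i \<and> (d ! i = e ! i \<longrightarrow> v i (d ! i) = one)" if "i < n" for i
          using 1 agree [of i] one [of i] that by (cases "i = 0") auto
        then show ?thesis by (simp add: dominated_def)
      next
        case 2
        have "e ! i \<le> d ! i \<and> (e ! i = d ! i \<longrightarrow> v i (e ! i) = one)" if "i < n" for i
          using 2 agree [of i] one [of i] that by (cases "i = 0") auto
        then show ?thesis by (simp add: dominated_def)
      qed
    qed
    then show False using S(2) de by blast
  qed
  \<comment> \<open>A singular cell has all terms equal to \<open>one\<close>, the least
    indecomposable, so moving it cannot decrease the width.\<close>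
  have nu: "nu d \<le> nu (m d)" if d: "d \<in> D" for d
  proof (rule nu_mono [OF mD [OF d]])
    fix i assume i: "i < n"
    show "v i (d ! i) \<le> v i (m d ! i)"
    proof (cases "singular d")
      case True
      then show ?thesis using i D_indecomposable [OF mD [OF d] i] by (simp add: singular_def indecomposable_one_le)
    qed (simp add: m_def)
  qed
  have "nsums.F nu S \<le> nsums.F (nu \<circ> m) S" using S(1) nu by (intro nsums_mono) auto
  also have "\<dots> = nsums.F nu (m ` S)" using nsums.reindex [OF inj] by simp
  finally have "W (vle n) X \<le> nsums.F nu (m ` S)" using S(3) by simp
  then show ?thesis
  proof (rule that [of "m ` S", rotated 3])
    show "m ` S \<subseteq> D" using S(1) mD by blast
    show "\<not> dominated d e" if "d \<in> m ` S" "e \<in> m ` S" "d \<noteq> e" for d e using that key by auto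
    show "\<not> singular d" if "d \<in> m ` S" for d using that S(1) nonsing by auto
  qed
qed

section \<open>The product with finite chains\<close>

lemma ofnat_le_iff: "(ofnat i :: 'o) \<le> ofnat j \<longleftrightarrow> i \<le> j"
  using ofnat_less [of i j] ofnat_less [of j i] by (cases i j rule: linorder_cases) auto

lemma narrow_XK: "narrow (pair_le n) (X \<times> K)"
  unfolding narrow_def
proof (intro conjI)
  show "\<forall>p\<in>X \<times> K. pair_le n p p" by (auto simp: pair_le_def vle_def list_all2_refl)
  have "finite K" unfolding K_def by (rule finite_list_all2_less)
  then have "small K" by (rule small_finite)
  moreover have "small X" using narrow_X by (simp add: narrow_def)
  ultimately show "small (X \<times> K)" by (intro small_Times)
  \<comment> \<open>Reading the finite coordinates as finite ordinals turns pairs into lists of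
    length \<open>n + length ks\<close> over one well-order.\<close>
  let ?f = "\<lambda>p. fst p @ map ofnat (snd p) :: 'o list"
  show "no_infinite_antichain (pair_le n) (X \<times> K)"
  proof (rule no_infinite_antichain_embed [OF no_infinite_antichain_vle, where f = ?f])
    fix p q assume pq: "p \<in> X \<times> K" "q \<in> X \<times> K" "vle (n + length ks) (?f p) (?f q)"
    have len: "length (fst p) = n" "length (fst q) = n" "length (snd p) = length ks" "length (snd q) = length ks"
      using pq(1,2) by (auto simp: X_def Box_def K_def dest: list_all2_lengthD)
    have le: "?f p ! i \<le> ?f q ! i" if "i < n + length ks" for i using pq(3) that by (simp add: vle_def)
    have "fst p ! i \<le> fst q ! i" if "i < n" for i
      using le [of i] that len by (simp add: nth_append)
    moreover have "snd p ! i \<le> snd q ! i" if "i < length ks" for i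
      using le [of "n + i"] that len by (simp add: nth_append ofnat_le_iff)
    ultimately show "pair_le n p q" using len by (simp add: pair_le_def vle_def list_all2_conv_all_nth)
  qed auto
qed

text \<open>The copies of \<open>X\<close> serve as cells without conflicts, and each projects into
  \<open>X\<close>.\<close>

lemma W_XK_le: "W (pair_le n) (X \<times> K) \<le> nmul (card K) (W (vle n) X)"
proof -
  have fin: "finite K" unfolding K_def by (rule finite_list_all2_less)
  have "\<exists>S\<subseteq>K. (\<forall>d\<in>S. \<forall>e\<in>S. d \<noteq> e \<longrightarrow> \<not> False) \<and>
    W (pair_le n) (X \<times> K) \<le> nsums.F (\<lambda>d. W (pair_le n) {p \<in> X \<times> K. snd p = d}) S"
    by (rule W_le_cells [OF narrow_XK fin]) auto
  then obtain S where S: "S \<subseteq> K" "W (pair_le n) (X \<times> K) \<le> nsums.F (\<lambda>d. W (pair_le n) {p \<in> X \<times> K. snd p = d}) S"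
    by blast
  have "nsums.F (\<lambda>d. W (pair_le n) {p \<in> X \<times> K. snd p = d}) S \<le> nsums.F (\<lambda>d. W (vle n) X) S"
  proof (rule nsums_mono)
    fix d
    show "W (pair_le n) {p \<in> X \<times> K. snd p = d} \<le> W (vle n) X"
      by (rule W_embed [where f = fst, OF narrow_subset [OF narrow_XK] narrow_X])
        (auto simp: pair_le_def list_all2_refl)
  qed
  also have "\<dots> \<le> nsums.F (\<lambda>d. W (vle n) X) K" using fin S(1) by (intro nsums_subset)
  finally show ?thesis using S(2) fin by (simp add: nsums_const)
qed

text \<open>Shifting inside every infinite block beyond the points of \<open>F\<close> there yields
  a copy of the cell that is incomparable to \<open>F\<close>. A cell that is not singular has such
  a block, which is what keeps its copies in \<open>X \<times> K\<close> apart.\<close>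

lemma nu_le_W_apart:
  assumes S: "S \<subseteq> D" "\<And>d e. d \<in> S \<Longrightarrow> e \<in> S \<Longrightarrow> d \<noteq> e \<Longrightarrow> \<not> dominated d e" "\<And>d. d \<in> S \<Longrightarrow> \<not> singular d"
    and d: "d \<in> S" and y: "y \<in> K" and F: "finite F"
    and before: "\<And>p. p \<in> F \<Longrightarrow> \<exists>e\<in>S. fst p \<in> cellset e \<and>
      (e = d \<longrightarrow> \<not> list_all2 (\<le>) (snd p) y) \<and> (e \<noteq> d \<longrightarrow> \<not> list_all2 (\<le>) e d)"
  shows "nu d \<le> W (pair_le n) (apart (pair_le n) (cellset d \<times> {y}) F)"
proof -
  have dD: "d \<in> D" using d S(1) by blast
  let ?R = "\<lambda>i. nsums.F (v i) {..<d ! i}"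
  \<comment> \<open>In a one-point block the only possible shift is \<open>ozero\<close>, and
    nothing has to be exceeded.\<close>
  have "\<exists>t. i < n \<longrightarrow> t < v i (d ! i) \<and> (v i (d ! i) \<noteq> one \<longrightarrow>
    (\<forall>p\<in>F. \<forall>x. fst p ! i \<in> block (v i) (d ! i) \<longrightarrow> fst p ! i < nsum (?R i) (nsum x t)))" for i
  proof (cases "i < n \<and> v i (d ! i) \<noteq> one")
    case True
    then have i: "i < n" "one < v i (d ! i)"
      using indecomposable_one_le [OF D_indecomposable [OF dD]] by (auto simp: order.not_eq_order_implies_strict)
    obtain t where "t < v i (d ! i)" "\<And>g x. g \<in> (\<lambda>p. fst p ! i) ` F \<Longrightarrow> g \<in> block (v i) (d ! i) \<Longrightarrow>
        g < nsum (?R i) (nsum x t)"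
      using block_shift_exceeds [OF nf [OF i(1)] D_nth [OF dD i(1)] i(2) finite_imageI [OF F]] by metis
    then show ?thesis by blast
  next
    case False
    then show ?thesis using indecomposable_pos [OF D_indecomposable [OF dD]] by blast
  qed
  then obtain t where t: "\<And>i. i < n \<Longrightarrow> t i < v i (d ! i)"
    "\<And>i p x. i < n \<Longrightarrow> v i (d ! i) \<noteq> one \<Longrightarrow> p \<in> F \<Longrightarrow> fst p ! i \<in> block (v i) (d ! i) \<Longrightarrow>
      fst p ! i < nsum (?R i) (nsum x (t i))"
    by metis
  define h where "h x = map (\<lambda>i. nsum (?R i) (nsum (x ! i) (t i))) [0..<n]" for x :: "'o list"
  have h: "h x ! i = nsum (?R i) (nsum (x ! i) (t i))" if "i < n" for x i using that by (simp add: h_def)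
  show ?thesis
    unfolding nu_def
  proof (rule W_embed [where f = "\<lambda>x. (h x, y)"])
    show "narrow (vle n) (Box n (\<lambda>i. v i (d ! i)))" by (rule narrow_cell_Box [OF dD])
    show "narrow (pair_le n) (apart (pair_le n) (cellset d \<times> {y}) F)"
      using cellset_subset_X [OF dD] y by (intro narrow_apart narrow_subset [OF narrow_XK]) auto
    show "vle n x x'" if "pair_le n (h x, y) (h x', y)" for x x'
      using that by (simp add: pair_le_def vle_def h nsum_le_cancel_left nsum_le_cancel_right)
    fix x assume x: "x \<in> Box n (\<lambda>i. v i (d ! i))"
    have blk: "h x ! i \<in> block (v i) (d ! i)" if i: "i < n" for i
      unfolding h [OF i] using x i t(1) [OF i] D_indecomposable [OF dD i]
      by (intro block_nsum indecomposable_nsum) (auto simp: Box_def)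
    then have "h x \<in> cellset d" by (simp add: cellset_def h_def)
    moreover have "\<not> pair_le n p (h x, y) \<and> \<not> pair_le n (h x, y) p" if p: "p \<in> F" for p
    proof -
      obtain e where e: "e \<in> S" "fst p \<in> cellset e" "e = d \<longrightarrow> \<not> list_all2 (\<le>) (snd p) y"
        "e \<noteq> d \<longrightarrow> \<not> list_all2 (\<le>) e d" using before [OF p] by blast
      have pe: "fst p ! i \<in> block (v i) (e ! i)" if "i < n" for i using e(2) that by (simp add: cellset_def)
      have exceeds: "\<not> pair_le n (h x, y) p" if "i < n" "e ! i = d ! i" "v i (d ! i) \<noteq> one" for i
      proof -
        have "fst p ! i < h x ! i" using t(2) [OF that(1,3) p] pe [OF that(1)] that by (simp add: h)
        then show ?thesis using that(1) by (auto simp: pair_le_def vle_def not_le)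
      qed
      show ?thesis
      proof (cases "e = d")
        case True
        \<comment> \<open>In this infinite block the shift puts \<open>h x\<close> above
          \<open>p\<close>; the other comparison is excluded by the copy indices.\<close>
        obtain i where "i < n" "v i (d ! i) \<noteq> one" using S(3) [OF d] by (auto simp: singular_def)
        then show ?thesis using exceeds True e(3) by (simp add: pair_le_def)
      next
        case False
        have len: "length e = n" "length d = n" using e(1) dD S(1) D_length by auto
        \<comment> \<open>Since \<open>e\<close> is not below \<open>d\<close>, the point
          \<open>p\<close> lies in a higher block in some coordinate.\<close>
        then obtain i where i: "i < n" "d ! i < e ! i"
          using e(4) False by (auto simp: list_all2_conv_all_nth not_le)
        then have "h x ! i < fst p ! i" using block_less [OF blk pe] by simp
        then have 1: "\<not> pair_le n p (h x, y)" using i(1) by (auto simp: pair_le_def vle_def not_le)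
        have "\<not> dominated d e" using S(2) d e(1) False by blast
        \<comment> \<open>Conversely, without domination some coordinate of \<open>p\<close> lies in
          a lower block or in a shared infinite block, where the shift exceeds it.\<close>
        then obtain j where j: "j < n" "e ! j < d ! j \<or> e ! j = d ! j \<and> v j (d ! j) \<noteq> one"
          by (auto simp: dominated_def not_le)
        have "\<not> pair_le n (h x, y) p"
        proof (cases "e ! j < d ! j")
          case True
          then have "fst p ! j < h x ! j" using block_less [OF pe blk] j(1) by simp
          then show ?thesis using j(1) by (auto simp: pair_le_def vle_def not_le)
        qed (use exceeds j in auto)
        with 1 show ?thesis by blast
      qed
    qed
    ultimately show "(h x, y) \<in> apart (pair_le n) (cellset d \<times> {y}) F" by (auto simp: apart_def)
  qed
qed

text \<open>All copies of the cells in \<open>S\<close> are played in turn, so that each width is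
  counted once for every element of \<open>K\<close>.\<close>

lemma W_XK_ge: "nmul (card K) (W (vle n) X) \<le> W (pair_le n) (X \<times> K)"
proof -
  obtain S where S: "S \<subseteq> D" "\<And>d e. d \<in> S \<Longrightarrow> e \<in> S \<Longrightarrow> d \<noteq> e \<Longrightarrow> \<not> dominated d e"
    "\<And>d. d \<in> S \<Longrightarrow> \<not> singular d" "W (vle n) X \<le> nsums.F nu S" by (rule W_X_le_nonsingular_cells) simp
  have finK: "finite K" unfolding K_def by (rule finite_list_all2_less)
  have finS: "finite S" using S(1) finite_D by (rule finite_subset)
  \<comment> \<open>An earlier cell is never below a later one, in the order of cells or, within the
    same cell, in the order of copies.\<close>
  define before where "before p q \<longleftrightarrow> (fst p = fst q \<longrightarrow> \<not> list_all2 (\<le>) (snd p) (snd q)) \<and>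
    (fst p \<noteq> fst q \<longrightarrow> \<not> list_all2 (\<le>) (fst p) (fst q))" for p q :: "nat list \<times> nat list"
  have "nsums.F (\<lambda>p. nu (fst p)) (S \<times> K) \<le> W (pair_le n) (X \<times> K)"
  proof (rule W_ge_nsums_cells [where B = "\<lambda>p. cellset (fst p) \<times> {snd p}" and before = before])
    show "finite (S \<times> K)" using finS finK by simp
    show "narrow (pair_le n) (X \<times> K)" by (rule narrow_XK)
    show "indecomposable (nu (fst p)) \<and> cellset (fst p) \<times> {snd p} \<subseteq> X \<times> K" if "p \<in> S \<times> K" for p
    proof -
      have "fst p \<in> D" using that S(1) by auto
      then show ?thesis using indecomposable_nu cellset_subset_X that by auto
    qed
  next
    fix T assume T: "T \<subseteq> S \<times> K" "T \<noteq> {}"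
    have finT: "finite T" using T(1) finS finK by (meson finite_SigmaI finite_subset)
    \<comment> \<open>The next cell has the least width; ties are broken by the largest index sum of
      the cell, then by the largest index sum of the copy.\<close>
    define c where "c = Min ((\<lambda>p. nu (fst p)) ` T)"
    define T1 where "T1 = {p \<in> T. nu (fst p) = c}"
    have "c \<in> (\<lambda>p. nu (fst p)) ` T" unfolding c_def using finT T(2) by (intro Min_in) auto
    then have "T1 \<noteq> {}" "finite T1" using finT by (auto simp: T1_def)
    then obtain p1 where p1: "p1 \<in> T1" "\<forall>q\<in>T1. sum_list (fst q) \<le> sum_list (fst p1)"
      using finite_has_maximal_value [of T1 "\<lambda>q. sum_list (fst q)"] by auto
    define T2 where "T2 = {p \<in> T1. fst p = fst p1}"
    have "p1 \<in> T2" "finite T2" using p1 \<open>finite T1\<close> by (auto simp: T2_def)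
    then obtain p where p: "p \<in> T2" "\<forall>q\<in>T2. sum_list (snd q) \<le> sum_list (snd p)"
      using finite_has_maximal_value [of T2 "\<lambda>q. sum_list (snd q)"] by blast
    have pT: "p \<in> T" "nu (fst p) = c" "fst p = fst p1" using p(1) by (auto simp: T2_def T1_def)
    have "before p q \<and> nu (fst p) \<le> nu (fst q)" if q: "q \<in> T - {p}" for q
    proof
      show le: "nu (fst p) \<le> nu (fst q)" unfolding pT(2) c_def using q finT by simp
      show "before p q"
        unfolding before_def
      proof (intro conjI impI notI)
        assume "fst p = fst q" "list_all2 (\<le>) (snd p) (snd q)"
        moreover from this have "snd p \<noteq> snd q" using q by (auto simp: prod_eq_iff)
        ultimately have "sum_list (snd p) < sum_list (snd q)" by (intro sum_list_strict_mono_list_all2)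
        moreover have "q \<in> T2" using q pT \<open>fst p = fst q\<close> by (auto simp: T2_def T1_def)
        ultimately show False using p(2) by (meson not_le)
      next
        assume *: "fst p \<noteq> fst q" "list_all2 (\<le>) (fst p) (fst q)"
        have "p \<in> S \<times> K" "q \<in> S \<times> K" using pT(1) q T(1) by auto
        then have "fst p \<in> D" "fst q \<in> D" using S(1) by auto
        \<comment> \<open>An upper cell is no wider, so \<open>q\<close> would also have the least
          width, against the maximal index sum of \<open>p1\<close>.\<close>
        then have "nu (fst q) \<le> nu (fst p)" using *(2) by (rule nu_antimono)
        then have "q \<in> T1" using le q pT by (auto simp: T1_def)
        moreover have "sum_list (fst p) < sum_list (fst q)" using * by (intro sum_list_strict_mono_list_all2)
        ultimately show False using p1(2) pT(3) by (metis not_le)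
      qed
    qed
    then show "\<exists>d\<in>T. \<forall>e\<in>T - {d}. before d e \<and> nu (fst d) \<le> nu (fst e)" using pT(1) by blast
  next
    fix e F assume e: "e \<in> S \<times> K" and F: "finite F"
      "F \<subseteq> (\<Union>d\<in>{d \<in> S \<times> K - {e}. before d e}. cellset (fst d) \<times> {snd d})"
    show "nu (fst e) \<le> W (pair_le n) (apart (pair_le n) (cellset (fst e) \<times> {snd e}) F)"
    proof (rule nu_le_W_apart [OF S(1-3)])
      fix p assume "p \<in> F"
      then obtain d where d: "d \<in> S \<times> K" "before d e" "p \<in> cellset (fst d) \<times> {snd d}" using F(2) by blast
      then show "\<exists>e'\<in>S. fst p \<in> cellset e' \<and> (e' = fst e \<longrightarrow> \<not> list_all2 (\<le>) (snd p) (snd e)) \<and>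
        (e' \<noteq> fst e \<longrightarrow> \<not> list_all2 (\<le>) e' (fst e))"
        by (intro bexI [of _ "fst d"]) (auto simp: before_def)
    qed (use e F(1) in auto)
  qed
  moreover have "nsums.F (\<lambda>p. nu (fst p)) (S \<times> K) = nmul (card K) (nsums.F nu S)"
  proof -
    have "nsums.F (\<lambda>p. nu (fst p)) (S \<times> K) = nsums.F (\<lambda>d. nsums.F (\<lambda>y. nu d) K) S"
      by (simp add: nsums.cartesian_product case_prod_beta)
    also have "\<dots> = nsums.F (\<lambda>y. nsums.F nu S) K" by (rule nsums.swap)
    finally show ?thesis using finK by (simp add: nsums_const)
  qed
  ultimately show ?thesis using nmul_mono [OF S(4), of "card K"] by simp
qed

end

theorem mainTheorem13:
  fixes alphas :: "'o::wellorder list" and ks :: "nat list"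
  assumes "regular_ordinal_type TYPE('o)"
    and "alphas \<noteq> []"
    and "\<forall>a\<in>set alphas. infinite {b. b < a}"
  shows "(width {(x, y). list_all2 (<) x alphas \<and> list_all2 (<) y ks}
            (\<lambda>(x, y) (x', y'). list_all2 (\<le>) x x' \<and> list_all2 (\<le>) y y') :: 'o)
         = foldl nprod (width {x. list_all2 (<) x alphas} (list_all2 (\<le>)))
             (map ofnat ks)"
proof -
  define n where "n = length alphas"
  \<comment> \<open>The largest factor bounds all factors and is itself infinite.\<close>
  define a0 where "a0 = Max (set alphas)"
  have "a0 \<in> set alphas" unfolding a0_def using assms(2) by (intro Max_in) auto
  then interpret regular_ordinals a0
    using assms(1,3) by unfold_locales (auto simp: lessThan_def)
  have "\<exists>v r. normal_form v r \<and> alphas ! i = nsums.F v {..<r}" for i by (rule normal_form_exists)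
  then obtain v r where vr: "\<And>i. normal_form (v i) (r i)" "\<And>i. alphas ! i = nsums.F (v i) {..<r i}" by metis
  interpret ordinal_product a0 n v r ks
  proof
    show "0 < n" using assms(2) by (simp add: n_def)
    fix i assume i: "i < n"
    then have "alphas ! i \<in> set alphas" by (simp add: n_def)
    then have "infinite {..<nsums.F (v i) {..<r i}}" using assms(3) vr(2) [of i] by (auto simp: lessThan_def)
    then show "0 < r i \<and> one < v i 0" using normal_form_infinite [OF vr(1)] by blast
    show "nsums.F (v i) {..<r i} \<le> a0"
      unfolding a0_def vr(2) [symmetric] using \<open>alphas ! i \<in> set alphas\<close> by simp
  qed (rule vr(1))
  have len: "length alphas = n" by (simp add: n_def)
  have X: "{x. list_all2 (<) x alphas} = X"
    using len by (auto simp: X_def Box_def list_all2_conv_all_nth vr(2))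
  have le: "list_all2 (\<le>) x x' \<longleftrightarrow> vle n x x'" if "x \<in> X" "x' \<in> X" for x x'
    using that by (auto simp: X_def Box_def vle_def list_all2_conv_all_nth)
  have "{(x, y). list_all2 (<) x alphas \<and> list_all2 (<) y ks} = X \<times> K"
    using X by (auto simp: K_def)
  then have "width {(x, y). list_all2 (<) x alphas \<and> list_all2 (<) y ks}
      (\<lambda>(x, y) (x', y'). list_all2 (\<le>) x x' \<and> list_all2 (\<le>) y y') = W (pair_le n) (X \<times> K)"
    by (auto simp: pair_le_def le intro!: width_cong)
  also have "\<dots> = nmul (card K) (W (vle n) X)"
    using W_XK_le W_XK_ge by (rule order.antisym)
  also have "W (vle n) X = width {x. list_all2 (<) x alphas} (list_all2 (\<le>))"
    unfolding X by (rule width_cong) (simp add: le)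
  also have "card K = prod_list ks" unfolding K_def by (rule card_list_all2_less)
  finally show ?thesis by (simp only: foldl_nprod_ofnat)
qed

end
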